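(* (Weak Monodromy Principle) Let $Q$ be a groupoid on a topological space $X$, let $s$ be a local subgroupoid of $Q$, let $\mathcal{U}_s=\{(U_i,H_i):i\in I\}$ be a globally adapted atlas for $s$, and let $K$ be a groupoid with object space $X$. A local morphism $f=\{f_i:H_i\to K,\ i\in I\}$ from $\mathcal{U}_s$ to $K$ defines uniquely a groupoid morphism $M(f):\mathrm{Mon}(s,\mathcal{U}_s)\to K$ over the identity on objects such that $M(f)|H_i=f_i$ for all $i\in I$ (where $H_i$ is regarded as a subset of $\mathrm{Mon}(s,\mathcal{U}_s)$ via $\tilde\imath$). Further, if $s$ is simply connected, then the $(f_i)$ determine a groupoid morphism $\mathrm{glob}(s)\to K$.
   Context: For a groupoid, $\alpha,\beta$ denote source and target, and the composite $uv$ is defined when $\beta u=\alpha v$. A subgroupoid is wide if it contains all the objects. Local subgroupoids: let $Q$ be a groupoid on a topological space $X$ (no topology on $Q$ itself is used); for $U$ open in $X$, $Q|U$ is the full subgroupoid on $U$, and $L_Q(U)$ is the set of wide subgroupoids of $Q|U$; with restriction maps $H\mapsto H|V$ this is a presheaf. A local subgroupoid $s$ of $Q$ is a global section of the associated sheaf; so $s(x)$ is a germ $[U,H]_x$ ($x\in U$ open, $H\in L_Q(U)$), where $[U,H]_x=[V,K]_x$ iff $H|W=K|W$ for some open $W$ with $x\in W\subseteq U\cap V$. An atlas $\mathcal{U}_s=\{(U_i,H_i):i\in I\}$ for $s$ is an open cover $\{U_i\}$ of $X$ with wide subgroupoids $H_i$ of $Q|U_i$ such that $s(x)=[U_i,H_i]_x$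 whenever $x\in U_i$. Partial order on germs: $[U',H']_x\leq[U,H]_x$ if $H'|W\subseteq H|W$ for some open $W$ with $x\in W\subseteq U\cap U'$; $s\leq t$ iff $s(x)\leq t(x)$ for all $x$. For a wide subgroupoid $H$ of $Q$, $\mathrm{loc}(H)(x)=[X,H]_x$. $\mathrm{glob}(s)$ is the intersection of all wide subgroupoids $H$ of $Q$ with $s\leq\mathrm{loc}(H)$. $\mathrm{glob}(\mathcal{U}_s)$ is the subgroupoid of $Q$ generated by all the $H_i$. The atlas is globally adapted if $\mathrm{glob}(s)=\mathrm{glob}(\mathcal{U}_s)$. Monodromy groupoid: for a globally adapted atlas put $W(\mathcal{U}_s)=\bigcup_{i\in I}H_i\subseteq\mathrm{glob}(s)$. It is a pregroupoid: it has restricted source and target maps and the partial composition $(u,v)\mapsto uv$ defined when $\beta u=\alpha v$ and $uv\in W(\mathcal{U}_s)$. A pregroupoid morphism to a groupoid preserves source and target and all such defined composites. $M(W(\mathcal{U}_s))$ is the quotient of the free groupoid on the graph $W(\mathcal{U}_s)$ by the normal subgroupoid imposing the relations $[uv]=[u][v]$ for all such $u,v$; let $\tilde\imath:W(\mathcal{U}_s)\to M(W(\mathcal{U}_s))$ be the canonical map. There is a unique groupoid morphism $p:M(W(\mathcal{U}_s))\to\mathrm{glob}(s)$ with $p\tilde\imath$ the inclusion, so $\tilde\imath$ is injective. For a globally adapted atlas, $M(W(\mathcal{U}_s))$ is called the monodromy groupoid and written $\mathrm{Mon}(s,\mathcal{U}_s)$. The local subgroupoid $s$ is called simply connected if it has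 a globally adapted atlas $\mathcal{U}_s$ such that the morphism $p:\mathrm{Mon}(s,\mathcal{U}_s)\to\mathrm{glob}(s)$ is an isomorphism. A local morphism from a globally adapted atlas $\mathcal{U}_s$ to a groupoid $K$ with object space $X$ is a family of groupoid morphisms $f_i:H_i\to K$ over the inclusions $U_i\to X$ with $f_i|(H_i\cap H_j)=f_j|(H_i\cap H_j)$ for all $i,j\in I$, such that the resulting function $W(\mathcal{U}_s)\to K$ is a pregroupoid morphism.
   Formalization: In the last sentence, "s is simply connected" is taken to mean that p is an isomorphism for the given atlas U_s; if only some other atlas of s has this property, the claim fails (four arcs on the circle, Q = X×X, K the fundamental groupoid). *)

theory Defs
  imports "HOL-Analysis.Abstract_Topology" "HOL-Library.FuncSet"
begin

section \<open>Groupoids and their morphisms\<close>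

record ('x, 'e) quiver =
  Obj :: "'x set"
  Arr :: "'e set"
  src :: "'e \<Rightarrow> 'x"
  tgt :: "'e \<Rightarrow> 'x"

text \<open>Composites are written in diagrammatic order: \<open>u \<cdot> v\<close> is meaningful
  when the target of \<open>u\<close> is the source of \<open>v\<close>.\<close>

record ('x, 'e) groupoid = "('x, 'e) quiver" +
  cmp :: "'e \<Rightarrow> 'e \<Rightarrow> 'e" (infixl "\<cdot>\<index>" 70)
  idt :: "'x \<Rightarrow> 'e"
  ginv :: "'e \<Rightarrow> 'e"

locale groupoid =
  fixes G :: "('x, 'e) groupoid" (structure)
  assumes src_closed: "a \<in> Arr G \<Longrightarrow> src G a \<in> Obj G"
    and tgt_closed: "a \<in> Arr G \<Longrightarrow> tgt G a \<in> Obj G"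
    and idt_closed: "x \<in> Obj G \<Longrightarrow> idt G x \<in> Arr G"
    and src_idt: "x \<in> Obj G \<Longrightarrow> src G (idt G x) = x"
    and tgt_idt: "x \<in> Obj G \<Longrightarrow> tgt G (idt G x) = x"
    and cmp_closed: "\<lbrakk>a \<in> Arr G; b \<in> Arr G; tgt G a = src G b\<rbrakk> \<Longrightarrow> a \<cdot> b \<in> Arr G"
    and src_cmp: "\<lbrakk>a \<in> Arr G; b \<in> Arr G; tgt G a = src G b\<rbrakk> \<Longrightarrow> src G (a \<cdot> b) = src G a"
    and tgt_cmp: "\<lbrakk>a \<in> Arr G; b \<in> Arr G; tgt G a = src G b\<rbrakk> \<Longrightarrow> tgt G (a \<cdot> b) = tgt G b"
    and cmp_assoc: "\<lbrakk>a \<in> Arr G; b \<in> Arr G; c \<in> Arr G; tgt G a = src G b; tgt G b = src G c\<rbrakk>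
      \<Longrightarrow> (a \<cdot> b) \<cdot> c = a \<cdot> (b \<cdot> c)"
    and idt_left: "a \<in> Arr G \<Longrightarrow> idt G (src G a) \<cdot> a = a"
    and idt_right: "a \<in> Arr G \<Longrightarrow> a \<cdot> idt G (tgt G a) = a"
    and ginv_closed: "a \<in> Arr G \<Longrightarrow> ginv G a \<in> Arr G"
    and src_ginv: "a \<in> Arr G \<Longrightarrow> src G (ginv G a) = tgt G a"
    and tgt_ginv: "a \<in> Arr G \<Longrightarrow> tgt G (ginv G a) = src G a"
    and ginv_right: "a \<in> Arr G \<Longrightarrow> a \<cdot> ginv G a = idt G (src G a)"
    and ginv_left: "a \<in> Arr G \<Longrightarrow> ginv G a \<cdot> a = idt G (tgt G a)"

text \<open>Groupoid morphisms whose effect on objects is the inclusion of the objects of the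
  domain into those of the codomain (the identity if the two object sets are equal).\<close>

definition groupoid_hom ::
  "('x, 'e) groupoid \<Rightarrow> ('x, 'k) groupoid \<Rightarrow> ('e \<Rightarrow> 'k) \<Rightarrow> bool" where
  "groupoid_hom G K f \<longleftrightarrow>
     Obj G \<subseteq> Obj K \<and>
     (\<forall>a\<in>Arr G. f a \<in> Arr K \<and> src K (f a) = src G a \<and> tgt K (f a) = tgt G a) \<and>
     (\<forall>x\<in>Obj G. f (idt G x) = idt K x) \<and>
     (\<forall>a\<in>Arr G. \<forall>b\<in>Arr G. tgt G a = src G b \<longrightarrow> f (a \<cdot>\<^bsub>G\<^esub> b) = f a \<cdot>\<^bsub>K\<^esub> f b)"

definition groupoid_iso ::
  "('x, 'e) groupoid \<Rightarrow> ('x, 'k) groupoid \<Rightarrow> ('e \<Rightarrow> 'k) \<Rightarrow> bool" where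
  "groupoid_iso G K f \<longleftrightarrow> groupoid_hom G K f \<and> Obj G = Obj K \<and> bij_betw f (Arr G) (Arr K)"

text \<open>Subgroupoids are represented by their sets of arrows; the objects are recovered
  from the identities.\<close>

definition subgroupoid :: "'e set \<Rightarrow> ('x, 'e) groupoid \<Rightarrow> bool" where
  "subgroupoid H G \<longleftrightarrow>
     H \<subseteq> Arr G \<and>
     (\<forall>a\<in>H. idt G (src G a) \<in> H \<and> idt G (tgt G a) \<in> H \<and> ginv G a \<in> H) \<and>
     (\<forall>a\<in>H. \<forall>b\<in>H. tgt G a = src G b \<longrightarrow> a \<cdot>\<^bsub>G\<^esub> b \<in> H)"

definition wide_subgroupoid :: "'e set \<Rightarrow> ('x, 'e) groupoid \<Rightarrow> bool" where
  "wide_subgroupoid H G \<longleftrightarrow> subgroupoid H G \<and> (\<forall>x\<in>Obj G. idt G x \<in> H)"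

definition generated_subgroupoid :: "('x, 'e) groupoid \<Rightarrow> 'e set \<Rightarrow> 'e set" where
  "generated_subgroupoid G S = \<Inter>{H. subgroupoid H G \<and> S \<subseteq> H}"


section \<open>Local subgroupoids\<close>

definition restr :: "('x, 'e) groupoid \<Rightarrow> 'e set \<Rightarrow> 'x set \<Rightarrow> 'e set" where
  "restr Q H V = {a \<in> H. src Q a \<in> V \<and> tgt Q a \<in> V}"

definition full_on :: "('x, 'e) groupoid \<Rightarrow> 'x set \<Rightarrow> ('x, 'e) groupoid" where
  "full_on Q U = Q\<lparr>Obj := U, Arr := restr Q (Arr Q) U\<rparr>"

definition L :: "('x, 'e) groupoid \<Rightarrow> 'x set \<Rightarrow> 'e set set" where
  "L Q U = {H. wide_subgroupoid H (full_on Q U)}"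

text \<open>The germ at \<open>x\<close> of a wide subgroupoid \<open>H\<close> of \<open>Q|U\<close>, as an equivalence class of pairs.\<close>

definition germ ::
  "'x topology \<Rightarrow> ('x, 'e) groupoid \<Rightarrow> 'x set \<Rightarrow> 'e set \<Rightarrow> 'x \<Rightarrow> ('x set \<times> 'e set) set" where
  "germ X Q U H x = {(V, K). openin X V \<and> x \<in> V \<and> K \<in> L Q V \<and>
     (\<exists>W. openin X W \<and> x \<in> W \<and> W \<subseteq> U \<inter> V \<and> restr Q H W = restr Q K W)}"

text \<open>Global sections of the associated sheaf: functions to the stalks that are locally
  induced by sections of the presheaf.\<close>

definition local_subgroupoid ::
  "'x topology \<Rightarrow> ('x, 'e) groupoid \<Rightarrow> ('x \<Rightarrow> ('x set \<times> 'e set) set) \<Rightarrow> bool" where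
  "local_subgroupoid X Q s \<longleftrightarrow>
     (\<forall>x\<in>topspace X. \<exists>U H. openin X U \<and> x \<in> U \<and> H \<in> L Q U \<and>
        (\<forall>y\<in>U. s y = germ X Q U H y))"

definition germ_le ::
  "'x topology \<Rightarrow> ('x, 'e) groupoid \<Rightarrow> 'x \<Rightarrow>
   ('x set \<times> 'e set) set \<Rightarrow> ('x set \<times> 'e set) set \<Rightarrow> bool" where
  "germ_le X Q x g' g \<longleftrightarrow>
     (\<exists>(U', H')\<in>g'. \<exists>(U, H)\<in>g. \<exists>W. openin X W \<and> x \<in> W \<and> W \<subseteq> U \<inter> U' \<and>
        restr Q H' W \<subseteq> restr Q H W)"

definition loc_le ::
  "'x topology \<Rightarrow> ('x, 'e) groupoid \<Rightarrow>
   ('x \<Rightarrow> ('x set \<times> 'e set) set) \<Rightarrow> ('x \<Rightarrow> ('x set \<times> 'e set) set) \<Rightarrow> bool" where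
  "loc_le X Q s t \<longleftrightarrow> (\<forall>x\<in>topspace X. germ_le X Q x (s x) (t x))"

definition loc ::
  "'x topology \<Rightarrow> ('x, 'e) groupoid \<Rightarrow> 'e set \<Rightarrow> 'x \<Rightarrow> ('x set \<times> 'e set) set" where
  "loc X Q H x = germ X Q (topspace X) H x"

definition glob ::
  "'x topology \<Rightarrow> ('x, 'e) groupoid \<Rightarrow> ('x \<Rightarrow> ('x set \<times> 'e set) set) \<Rightarrow> 'e set" where
  "glob X Q s = \<Inter>{H. wide_subgroupoid H Q \<and> loc_le X Q s (loc X Q H)}"

text \<open>The intersection defining \<open>glob X Q s\<close> as a groupoid on all the objects of \<open>Q\<close>.\<close>

definition glob_groupoid ::
  "'x topology \<Rightarrow> ('x, 'e) groupoid \<Rightarrow> ('x \<Rightarrow> ('x set \<times> 'e set) set) \<Rightarrow> ('x, 'e) groupoid" where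
  "glob_groupoid X Q s = Q\<lparr>Arr := glob X Q s\<rparr>"

definition atlas ::
  "'x topology \<Rightarrow> ('x, 'e) groupoid \<Rightarrow> ('x \<Rightarrow> ('x set \<times> 'e set) set) \<Rightarrow>
   'i set \<Rightarrow> ('i \<Rightarrow> 'x set) \<Rightarrow> ('i \<Rightarrow> 'e set) \<Rightarrow> bool" where
  "atlas X Q s I U H \<longleftrightarrow>
     (\<forall>i\<in>I. openin X (U i) \<and> H i \<in> L Q (U i)) \<and>
     (\<Union>i\<in>I. U i) = topspace X \<and>
     (\<forall>i\<in>I. \<forall>x\<in>U i. s x = germ X Q (U i) (H i) x)"

definition glob_atlas :: "('x, 'e) groupoid \<Rightarrow> 'i set \<Rightarrow> ('i \<Rightarrow> 'e set) \<Rightarrow> 'e set" where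
  "glob_atlas Q I H = generated_subgroupoid Q (\<Union>i\<in>I. H i)"

definition globally_adapted ::
  "'x topology \<Rightarrow> ('x, 'e) groupoid \<Rightarrow> ('x \<Rightarrow> ('x set \<times> 'e set) set) \<Rightarrow>
   'i set \<Rightarrow> ('i \<Rightarrow> 'x set) \<Rightarrow> ('i \<Rightarrow> 'e set) \<Rightarrow> bool" where
  "globally_adapted X Q s I U H \<longleftrightarrow> atlas X Q s I U H \<and> glob X Q s = glob_atlas Q I H"


section \<open>Free groupoids\<close>

text \<open>A letter \<open>(e, True)\<close> is the edge \<open>e\<close>, and \<open>(e, False)\<close> is its formal inverse.\<close>

definition lsrc :: "('x, 'e, 'm) quiver_scheme \<Rightarrow> 'e \<times> bool \<Rightarrow> 'x" where
  "lsrc G l = (if snd l then src G (fst l) else tgt G (fst l))"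

definition ltgt :: "('x, 'e, 'm) quiver_scheme \<Rightarrow> 'e \<times> bool \<Rightarrow> 'x" where
  "ltgt G l = (if snd l then tgt G (fst l) else src G (fst l))"

definition flip :: "'e \<times> bool \<Rightarrow> 'e \<times> bool" where
  "flip l = (fst l, \<not> snd l)"

fun is_walk :: "('x, 'e, 'm) quiver_scheme \<Rightarrow> 'x \<Rightarrow> ('e \<times> bool) list \<Rightarrow> 'x \<Rightarrow> bool" where
  "is_walk G x [] y \<longleftrightarrow> x \<in> Obj G \<and> x = y"
| "is_walk G x (l # w) y \<longleftrightarrow> x \<in> Obj G \<and> fst l \<in> Arr G \<and> lsrc G l = x \<and> is_walk G (ltgt G l) w y"

text \<open>Words carry their end points, so that the empty words at different objects differ.\<close>

type_synonym ('x, 'e) path = "'x \<times> ('e \<times> bool) list \<times> 'x"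

definition paths :: "('x, 'e, 'm) quiver_scheme \<Rightarrow> ('x, 'e) path set" where
  "paths G = {(x, w, y). is_walk G x w y}"

definition cancel :: "('x, 'e, 'm) quiver_scheme \<Rightarrow> ('x, 'e) path rel" where
  "cancel G = {((x, v @ [l, flip l] @ w, y), (x, v @ w, y)) | x v l w y.
     is_walk G x (v @ [l, flip l] @ w) y}"

definition path_class :: "('x, 'e, 'm) quiver_scheme \<Rightarrow> ('x, 'e) path \<Rightarrow> ('x, 'e) path set" where
  "path_class G p = (cancel G \<union> (cancel G)\<inverse>)\<^sup>* `` {p}"

definition free_groupoid ::
  "('x, 'e, 'm) quiver_scheme \<Rightarrow> ('x, ('x, 'e) path set) groupoid" where
  "free_groupoid G = \<lparr>
     Obj = Obj G,
     Arr = path_class G ` paths G,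
     src = (\<lambda>C. the_elem ((\<lambda>(x, w, y). x) ` C)),
     tgt = (\<lambda>C. the_elem ((\<lambda>(x, w, y). y) ` C)),
     cmp = (\<lambda>C D. \<Union>(x, v, y)\<in>C. \<Union>(y', w, z)\<in>D. path_class G (x, v @ w, z)),
     idt = (\<lambda>x. path_class G (x, [], x)),
     ginv = (\<lambda>C. \<Union>(x, w, y)\<in>C. path_class G (y, rev (map flip w), x))\<rparr>"

definition free_gen :: "('x, 'e, 'm) quiver_scheme \<Rightarrow> 'e \<Rightarrow> ('x, 'e) path set" where
  "free_gen G e = path_class G (src G e, [(e, True)], tgt G e)"


section \<open>Normal subgroupoids and quotients\<close>

definition normal_subgroupoid :: "'e set \<Rightarrow> ('x, 'e) groupoid \<Rightarrow> bool" where
  "normal_subgroupoid N G \<longleftrightarrow>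
     wide_subgroupoid N G \<and>
     (\<forall>a\<in>Arr G. \<forall>n\<in>N. src G n = src G a \<and> tgt G n = src G a \<longrightarrow>
        (ginv G a \<cdot>\<^bsub>G\<^esub> n) \<cdot>\<^bsub>G\<^esub> a \<in> N)"

definition normal_closure :: "('x, 'e) groupoid \<Rightarrow> 'e set \<Rightarrow> 'e set" where
  "normal_closure G R = \<Inter>{N. normal_subgroupoid N G \<and> R \<subseteq> N}"

text \<open>The quotient by a totally disconnected normal subgroupoid (one all of whose arrows
  are loops), which leaves the objects unchanged. The normal closure of a set of loops is
  totally disconnected.\<close>

definition coset :: "('x, 'e) groupoid \<Rightarrow> 'e set \<Rightarrow> 'e \<Rightarrow> 'e set" where
  "coset G N a = {b \<in> Arr G. src G b = src G a \<and> tgt G b = tgt G a \<and> b \<cdot>\<^bsub>G\<^esub> ginv G a \<in> N}"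

definition quotient_groupoid :: "('x, 'e) groupoid \<Rightarrow> 'e set \<Rightarrow> ('x, 'e set) groupoid" where
  "quotient_groupoid G N = \<lparr>
     Obj = Obj G,
     Arr = coset G N ` Arr G,
     src = (\<lambda>C. the_elem (src G ` C)),
     tgt = (\<lambda>C. the_elem (tgt G ` C)),
     cmp = (\<lambda>C D. \<Union>a\<in>C. \<Union>b\<in>D. coset G N (a \<cdot>\<^bsub>G\<^esub> b)),
     idt = (\<lambda>x. coset G N (idt G x)),
     ginv = (\<lambda>C. \<Union>a\<in>C. coset G N (ginv G a))\<rparr>"


section \<open>Pregroupoids and the monodromy groupoid\<close>

text \<open>A pregroupoid \<open>P\<close> is given by a structure whose operation \<open>u \<cdot> v\<close> only counts
  as defined when \<open>u\<close>, \<open>v\<close> are composable and \<open>u \<cdot> v\<close> lies in \<open>Arr P\<close>.\<close>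

definition defined_comp :: "('x, 'e) groupoid \<Rightarrow> 'e \<Rightarrow> 'e \<Rightarrow> bool" where
  "defined_comp P u v \<longleftrightarrow>
     u \<in> Arr P \<and> v \<in> Arr P \<and> tgt P u = src P v \<and> u \<cdot>\<^bsub>P\<^esub> v \<in> Arr P"

definition pregroupoid_hom ::
  "('x, 'e) groupoid \<Rightarrow> ('x, 'k) groupoid \<Rightarrow> ('e \<Rightarrow> 'k) \<Rightarrow> bool" where
  "pregroupoid_hom P K f \<longleftrightarrow>
     (\<forall>u\<in>Arr P. f u \<in> Arr K \<and> src K (f u) = src P u \<and> tgt K (f u) = tgt P u) \<and>
     (\<forall>u v. defined_comp P u v \<longrightarrow> f (u \<cdot>\<^bsub>P\<^esub> v) = f u \<cdot>\<^bsub>K\<^esub> f v)"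

definition relators :: "('x, 'e) groupoid \<Rightarrow> ('x, 'e) path set set" where
  "relators P =
     {(free_gen P u \<cdot>\<^bsub>free_groupoid P\<^esub> free_gen P v) \<cdot>\<^bsub>free_groupoid P\<^esub>
        ginv (free_groupoid P) (free_gen P (u \<cdot>\<^bsub>P\<^esub> v)) | u v. defined_comp P u v}"

definition M :: "('x, 'e) groupoid \<Rightarrow> ('x, ('x, 'e) path set set) groupoid" where
  "M P = quotient_groupoid (free_groupoid P) (normal_closure (free_groupoid P) (relators P))"

definition M_incl :: "('x, 'e) groupoid \<Rightarrow> 'e \<Rightarrow> ('x, 'e) path set set" where
  "M_incl P u =
     coset (free_groupoid P) (normal_closure (free_groupoid P) (relators P)) (free_gen P u)"

definition atlas_pregroupoid ::
  "('x, 'e) groupoid \<Rightarrow> 'i set \<Rightarrow> ('i \<Rightarrow> 'e set) \<Rightarrow> ('x, 'e) groupoid" where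
  "atlas_pregroupoid Q I H = Q\<lparr>Arr := (\<Union>i\<in>I. H i)\<rparr>"

definition Mon ::
  "('x, 'e) groupoid \<Rightarrow> 'i set \<Rightarrow> ('i \<Rightarrow> 'e set) \<Rightarrow> ('x, ('x, 'e) path set set) groupoid" where
  "Mon Q I H = M (atlas_pregroupoid Q I H)"

definition Mon_incl ::
  "('x, 'e) groupoid \<Rightarrow> 'i set \<Rightarrow> ('i \<Rightarrow> 'e set) \<Rightarrow> 'e \<Rightarrow> ('x, 'e) path set set" where
  "Mon_incl Q I H = M_incl (atlas_pregroupoid Q I H)"

definition Mon_proj ::
  "'x topology \<Rightarrow> ('x, 'e) groupoid \<Rightarrow> ('x \<Rightarrow> ('x set \<times> 'e set) set) \<Rightarrow>
   'i set \<Rightarrow> ('i \<Rightarrow> 'e set) \<Rightarrow> ('x, 'e) path set set \<Rightarrow> 'e" where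
  "Mon_proj X Q s I H =
     (THE p. p \<in> extensional (Arr (Mon Q I H)) \<and>
             groupoid_hom (Mon Q I H) (glob_groupoid X Q s) p \<and>
             (\<forall>u\<in>(\<Union>i\<in>I. H i). p (Mon_incl Q I H u) = u))"

text \<open>The atlas exhibits \<open>s\<close> as simply connected.\<close>

definition simply_connected_via ::
  "'x topology \<Rightarrow> ('x, 'e) groupoid \<Rightarrow> ('x \<Rightarrow> ('x set \<times> 'e set) set) \<Rightarrow>
   'i set \<Rightarrow> ('i \<Rightarrow> 'x set) \<Rightarrow> ('i \<Rightarrow> 'e set) \<Rightarrow> bool" where
  "simply_connected_via X Q s I U H \<longleftrightarrow>
     globally_adapted X Q s I U H \<and>
     groupoid_iso (Mon Q I H) (glob_groupoid X Q s) (Mon_proj X Q s I H)"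

text \<open>The index type of the bound atlas is no restriction: every atlas can be indexed by
  the set of its members \<open>(U i, H i)\<close>, and neither \<open>glob_atlas\<close> nor \<open>Mon\<close> changes.\<close>

definition simply_connected_local ::
  "'x topology \<Rightarrow> ('x, 'e) groupoid \<Rightarrow> ('x \<Rightarrow> ('x set \<times> 'e set) set) \<Rightarrow> bool" where
  "simply_connected_local X Q s \<longleftrightarrow>
     (\<exists>(I :: ('x set \<times> 'e set) set) U H. simply_connected_via X Q s I U H)"


section \<open>Local morphisms\<close>

text \<open>The function on the union of the \<open>H i\<close> resulting from a compatible family.\<close>

definition glue :: "'i set \<Rightarrow> ('i \<Rightarrow> 'e set) \<Rightarrow> ('i \<Rightarrow> 'e \<Rightarrow> 'k) \<Rightarrow> 'e \<Rightarrow> 'k" where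
  "glue I H f u = f (SOME i. i \<in> I \<and> u \<in> H i) u"

definition local_morphism ::
  "('x, 'e) groupoid \<Rightarrow> 'i set \<Rightarrow> ('i \<Rightarrow> 'x set) \<Rightarrow> ('i \<Rightarrow> 'e set) \<Rightarrow>
   ('x, 'k) groupoid \<Rightarrow> ('i \<Rightarrow> 'e \<Rightarrow> 'k) \<Rightarrow> bool" where
  "local_morphism Q I U H K f \<longleftrightarrow>
     (\<forall>i\<in>I. groupoid_hom (Q\<lparr>Obj := U i, Arr := H i\<rparr>) K (f i)) \<and>
     (\<forall>i\<in>I. \<forall>j\<in>I. \<forall>u\<in>H i \<inter> H j. f i u = f j u) \<and>
     pregroupoid_hom (atlas_pregroupoid Q I H) K (glue I H f)"

end

theory Submission
  imports Defs
begin

text \<open>The first assertion is the universal property of \<open>M(W)\<close>: morphisms from the pregroupoid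
  \<open>W = \<Union>i. H i\<close> to \<open>K\<close> correspond to groupoid morphisms \<open>M(W) \<rightarrow> K\<close>.  A local
  morphism \<open>f\<close> is such a pregroupoid morphism, cut into its restrictions \<open>f i\<close> to the \<open>H i\<close>.  The universal
  property comes in two steps, matching the two steps of the construction.  A map of the edges of
  a graph into \<open>K\<close> extends to words by multiplying out the values of the letters; cancelling a
  letter against its inverse does not change the product, so the extension lives on the free
  groupoid (\<open>free_groupoid_ext\<close>).  If the map respects the defined composites of \<open>W\<close>, its extension
  sends every relator to an identity.  The arrows sent to identities form a normal subgroupoid,
  which then contains the normal closure of the relators, and the extension factors through the
  quotient (\<open>quotient_factor\<close>).  For uniqueness, two morphisms agreeing on the generators agree on
  their inverses, hence on all words (\<open>free_groupoid_hom_ext\<close>), and the quotient map is onto.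

  The operations on path classes and on cosets are unions over all representatives.  Most of the
  work is to see that they do not depend on the representatives, after which the groupoid laws are
  those of concatenation of words and of the groupoid being divided out.

  For the second assertion, global adaptedness gives \<open>W \<subseteq> glob(s)\<close> and makes \<open>glob(s)\<close> a
  wide subgroupoid, hence a groupoid.  The universal property applied to the inclusion of \<open>W\<close>
  in \<open>glob(s)\<close> identifies the projection \<open>p\<close>.  If \<open>p\<close> is an isomorphism, then \<open>M(f) \<circ> p\<inverse>\<close>
  is the required morphism on \<open>glob(s)\<close>; any other choice gives the same morphism after composition
  with \<open>p\<close>, which is surjective.  This holds for every atlas and every target, so it
  settles the version for an atlas supplied by simple connectivity of \<open>s\<close> as well.\<close>

section \<open>Groupoid algebra\<close>

context groupoid
begin

text \<open>As rewrite rules these axioms, together with the cancellation laws and the formula for the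
  inverse of a composite proved below, bring every composite into a right-bracketed reduced form.
  This decides the identities between composites that occur for cosets.\<close>

declare src_closed [simp] tgt_closed [simp] idt_closed [simp] src_idt [simp] tgt_idt [simp]
  cmp_closed [simp] src_cmp [simp] tgt_cmp [simp] cmp_assoc [simp] idt_left [simp] idt_right [simp]
  ginv_closed [simp] src_ginv [simp] tgt_ginv [simp] ginv_right [simp] ginv_left [simp]

lemma idt_cmp [simp]: "\<lbrakk>a \<in> Arr G; src G a = x\<rbrakk> \<Longrightarrow> idt G x \<cdot> a = a"
  by auto

lemma cmp_idt [simp]: "\<lbrakk>a \<in> Arr G; tgt G a = x\<rbrakk> \<Longrightarrow> a \<cdot> idt G x = a"
  by auto

lemma ginv_cancel_left [simp]:
  assumes "a \<in> Arr G" "b \<in> Arr G" "tgt G a = src G b"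
  shows "ginv G a \<cdot> (a \<cdot> b) = b"
  using assms cmp_assoc[of "ginv G a" a b] by simp

lemma cmp_ginv_cancel_left [simp]:
  assumes "a \<in> Arr G" "b \<in> Arr G" "src G a = src G b"
  shows "a \<cdot> (ginv G a \<cdot> b) = b"
  using assms cmp_assoc[of a "ginv G a" b] by simp

lemma ginv_unique:
  assumes "a \<in> Arr G" "b \<in> Arr G" "tgt G a = src G b" "a \<cdot> b = idt G (src G a)"
  shows "b = ginv G a"
  using assms ginv_cancel_left[of a b] by simp

lemma ginv_ginv [simp]: "a \<in> Arr G \<Longrightarrow> ginv G (ginv G a) = a"
  by (rule ginv_unique[symmetric]) auto

lemma ginv_idt [simp]: "x \<in> Obj G \<Longrightarrow> ginv G (idt G x) = idt G x"
  by (rule ginv_unique[symmetric]) auto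

lemma ginv_cmp [simp]:
  assumes "a \<in> Arr G" "b \<in> Arr G" "tgt G a = src G b"
  shows "ginv G (a \<cdot> b) = ginv G b \<cdot> ginv G a"
  by (rule ginv_unique[symmetric]) (use assms in auto)

lemma normal_subgroupoid_Arr: "normal_subgroupoid (Arr G) G"
  unfolding normal_subgroupoid_def wide_subgroupoid_def subgroupoid_def by auto

lemma wide_subgroupoid_groupoid:
  assumes "wide_subgroupoid H G"
  shows "groupoid (G\<lparr>Arr := H\<rparr>)"
  using assms unfolding wide_subgroupoid_def subgroupoid_def
  by unfold_locales (auto simp: subset_iff)

end

lemma groupoid_homD:
  assumes "groupoid_hom G K f"
  shows "x \<in> Obj G \<Longrightarrow> x \<in> Obj K"
    and "a \<in> Arr G \<Longrightarrow> f a \<in> Arr K"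
    and "a \<in> Arr G \<Longrightarrow> src K (f a) = src G a"
    and "a \<in> Arr G \<Longrightarrow> tgt K (f a) = tgt G a"
    and "x \<in> Obj G \<Longrightarrow> f (idt G x) = idt K x"
    and "\<lbrakk>a \<in> Arr G; b \<in> Arr G; tgt G a = src G b\<rbrakk> \<Longrightarrow> f (a \<cdot>\<^bsub>G\<^esub> b) = f a \<cdot>\<^bsub>K\<^esub> f b"
  using assms unfolding groupoid_hom_def by auto

text \<open>Preservation of inverses follows from that of composites and identities, because an
  inverse is determined by its defining equation.\<close>

lemma groupoid_hom_ginv:
  assumes "groupoid G" "groupoid K" and f: "groupoid_hom G K f" and a: "a \<in> Arr G"
  shows "f (ginv G a) = ginv K (f a)"
proof -
  interpret G: groupoid G by fact
  interpret K: groupoid K by fact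
  show ?thesis
    by (rule K.ginv_unique)
      (use a groupoid_homD[OF f] groupoid_homD(6)[OF f a, of "ginv G a", symmetric] in auto)
qed

lemma groupoid_hom_compose:
  assumes "groupoid_hom G H f" "groupoid_hom H K g"
  shows "groupoid_hom G K (g \<circ> f)"
  using assms unfolding groupoid_hom_def by auto

lemma groupoid_hom_cong:
  assumes "groupoid G" and f: "groupoid_hom G K f" and "\<And>a. a \<in> Arr G \<Longrightarrow> g a = f a"
  shows "groupoid_hom G K g"
proof -
  interpret groupoid G by fact
  show ?thesis using f assms(3) unfolding groupoid_hom_def by simp
qed

lemma groupoid_hom_inv_into:
  assumes "groupoid G" and iso: "groupoid_iso G K p"
  shows "groupoid_hom K G (inv_into (Arr G) p)"
proof -
  interpret groupoid G by fact
  let ?q = "inv_into (Arr G) p"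
  have p: "groupoid_hom G K p" and O: "Obj G = Obj K" and b: "bij_betw p (Arr G) (Arr K)"
    using iso by (auto simp: groupoid_iso_def)
  have q: "?q a \<in> Arr G" "p (?q a) = a" if "a \<in> Arr K" for a
    using that b by (auto simp: bij_betw_def inv_into_into f_inv_into_f)
  have qp: "?q (p a) = a" if "a \<in> Arr G" for a
    using that b by (simp add: bij_betw_def)
  have ends: "src G (?q a) = src K a" "tgt G (?q a) = tgt K a" if "a \<in> Arr K" for a
    using q[OF that] groupoid_homD(3,4)[OF p, of "?q a"] by auto
  have "?q (idt K x) = idt G x" if "x \<in> Obj K" for x
    using qp[of "idt G x"] that O groupoid_homD(5)[OF p, of x] by simp
  moreover have "?q (a \<cdot>\<^bsub>K\<^esub> b) = ?q a \<cdot>\<^bsub>G\<^esub> ?q b"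
    if "a \<in> Arr K" "b \<in> Arr K" "tgt K a = src K b" for a b
    using qp[of "?q a \<cdot>\<^bsub>G\<^esub> ?q b"] groupoid_homD(6)[OF p, of "?q a" "?q b"] q ends that by simp
  ultimately show ?thesis
    using O q ends unfolding groupoid_hom_def by simp
qed


section \<open>Words and their equivalence\<close>

lemma is_walk_start: "is_walk G x w y \<Longrightarrow> x \<in> Obj G"
  by (cases w) auto

lemma is_walk_end: "is_walk G x w y \<Longrightarrow> y \<in> Obj G"
  by (induction w arbitrary: x) auto

lemma is_walk_append:
  "is_walk G x (v @ w) y \<longleftrightarrow> (\<exists>z. is_walk G x v z \<and> is_walk G z w y)"
  by (induction v arbitrary: x) (auto dest: is_walk_start)

lemma flip_simps [simp]:
  "fst (flip l) = fst l" "lsrc G (flip l) = ltgt G l" "ltgt G (flip l) = lsrc G l"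
  "flip (flip l) = l"
  by (auto simp: flip_def lsrc_def ltgt_def)

lemma is_walk_reverse: "is_walk G x w y \<Longrightarrow> is_walk G y (rev (map flip w)) x"
  by (induction w arbitrary: x) (auto simp: is_walk_append dest: is_walk_start)

text \<open>Path classes are the classes of this relation; as a closure it is reflexive and
  transitive by construction, and symmetric because the generating relation has been symmetrised.\<close>

definition path_equiv :: "('x, 'e, 'm) quiver_scheme \<Rightarrow> ('x, 'e) path rel" where
  "path_equiv G = (cancel G \<union> (cancel G)\<inverse>)\<^sup>*"

lemma path_equiv_refl [simp]: "(p, p) \<in> path_equiv G"
  by (simp add: path_equiv_def)

lemma path_equiv_sym: "(p, q) \<in> path_equiv G \<Longrightarrow> (q, p) \<in> path_equiv G"
  unfolding path_equiv_def by (rule symD[OF sym_rtrancl]) (auto intro: symI)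

lemma path_equiv_trans:
  "(p, q) \<in> path_equiv G \<Longrightarrow> (q, r) \<in> path_equiv G \<Longrightarrow> (p, r) \<in> path_equiv G"
  unfolding path_equiv_def by (rule rtrancl_trans)

lemma path_class_iff: "q \<in> path_class G p \<longleftrightarrow> (p, q) \<in> path_equiv G"
  by (simp add: path_class_def path_equiv_def)

lemma path_class_eq_iff: "path_class G p = path_class G q \<longleftrightarrow> (p, q) \<in> path_equiv G"
  unfolding set_eq_iff path_class_iff by (metis path_equiv_refl path_equiv_sym path_equiv_trans)

lemma path_class_self [simp]: "p \<in> path_class G p"
  by (simp add: path_class_iff)

lemma cancelI:
  "is_walk G x (v @ l # flip l # w) y \<Longrightarrow> ((x, v @ l # flip l # w, y), (x, v @ w, y)) \<in> cancel G"
  unfolding cancel_def mem_Collect_eq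
  by (intro exI[of _ x] exI[of _ v] exI[of _ l] exI[of _ w] exI[of _ y]) simp

lemma cancelE:
  assumes "(p, q) \<in> cancel G"
  obtains x v l w y where "p = (x, v @ l # flip l # w, y)" "q = (x, v @ w, y)"
    "is_walk G x (v @ l # flip l # w) y" "is_walk G x (v @ w) y"
proof -
  from assms obtain x v l w y where "p = (x, v @ [l, flip l] @ w, y)" "q = (x, v @ w, y)"
    "is_walk G x (v @ [l, flip l] @ w) y"
    unfolding cancel_def by blast
  then show thesis using that[of x v l w y] by (auto simp: is_walk_append)
qed

text \<open>Cancellation and its reverse keep the end points and keep walks walks.  An equivalence of
  walks from \<open>x\<close> to \<open>y\<close> can thus be followed on the words alone, with \<open>x\<close> and \<open>y\<close> fixed: any
  equivalence relation \<open>P\<close> on words that absorbs single cancellations holds between its two ends.\<close>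

lemma path_equiv_walk_induct:
  assumes "((x, v, y), q) \<in> path_equiv G" "is_walk G x v y"
    and refl: "\<And>v. is_walk G x v y \<Longrightarrow> P v v"
    and cancel: "\<And>v l w. is_walk G x (v @ l # flip l # w) y \<Longrightarrow> P (v @ l # flip l # w) (v @ w)"
    and sym: "\<And>v w. P v w \<Longrightarrow> P w v"
    and trans: "\<And>u v w. P u v \<Longrightarrow> P v w \<Longrightarrow> P u w"
  shows "\<exists>w. q = (x, w, y) \<and> is_walk G x w y \<and> P v w"
  using assms(1) unfolding path_equiv_def
proof (induction rule: rtrancl_induct)
  case base
  then show ?case using assms(2) refl by simp
next
  case (step q r)
  then obtain w where w: "q = (x, w, y)" "is_walk G x w y" "P v w" by blast
  from step(2) have "(q, r) \<in> cancel G \<or> (r, q) \<in> cancel G" by simp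
  then have "\<exists>w'. r = (x, w', y) \<and> is_walk G x w' y \<and> P w w'"
  proof
    assume "(q, r) \<in> cancel G"
    then obtain v l u where u: "w = v @ l # flip l # u" "r = (x, v @ u, y)" "is_walk G x (v @ u) y"
      using w(1) by (elim cancelE) auto
    from cancel[of v l u] w(2) u show ?thesis by simp
  next
    assume "(r, q) \<in> cancel G"
    then obtain v l u where u: "w = v @ u" "r = (x, v @ l # flip l # u, y)"
      "is_walk G x (v @ l # flip l # u) y"
      using w(1) by (elim cancelE) auto
    from sym[OF cancel[OF u(3)]] u show ?thesis by simp
  qed
  then obtain w' where w': "r = (x, w', y)" "is_walk G x w' y" "P w w'" by blast
  from trans[OF w(3) w'(3)] w' show ?case by simp
qed

lemma path_equiv_walk:
  assumes "((x, v, y), q) \<in> path_equiv G" "is_walk G x v y"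
  obtains w where "q = (x, w, y)" "is_walk G x w y"
  using path_equiv_walk_induct[OF assms, of "\<lambda>_ _. True"] by auto

text \<open>The form used when both words are given.  All the well-definedness statements about path
  classes are instances of it.\<close>

lemma path_equiv_induct [consumes 2, case_names refl cancel sym trans]:
  assumes "((x, v, y), (x, v', y)) \<in> path_equiv G" "is_walk G x v y"
    and "\<And>v. is_walk G x v y \<Longrightarrow> P v v"
    and "\<And>v l w. is_walk G x (v @ l # flip l # w) y \<Longrightarrow> P (v @ l # flip l # w) (v @ w)"
    and "\<And>v w. P v w \<Longrightarrow> P w v"
    and "\<And>u v w. P u v \<Longrightarrow> P v w \<Longrightarrow> P u w"
  shows "P v v'"
proof -
  have "\<exists>w. (x, v', y) = (x, w, y) \<and> is_walk G x w y \<and> P v w"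
    by (rule path_equiv_walk_induct[OF assms(1,2)]) (fact assms)+
  then show ?thesis by simp
qed

lemma path_equiv_cancel:
  assumes "is_walk G x (v @ l # flip l # w) y"
  shows "((x, v @ l # flip l # w, y), (x, v @ w, y)) \<in> path_equiv G"
  using cancelI[OF assms] by (auto simp: path_equiv_def)

lemma path_equiv_append_right:
  assumes "((x, v, y), (x, v', y)) \<in> path_equiv G" "is_walk G x v y" "is_walk G y u z"
  shows "((x, v @ u, z), (x, v' @ u, z)) \<in> path_equiv G"
  using assms(1,2)
proof (induction rule: path_equiv_induct)
  case (cancel v l w)
  then have "is_walk G x (v @ l # flip l # w @ u) z"
    using assms(3) is_walk_append[of G x "v @ l # flip l # w" u z] by auto
  then show ?case using path_equiv_cancel by fastforce
qed (rule path_equiv_refl | erule path_equiv_sym | erule (1) path_equiv_trans)+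

lemma path_equiv_append_left:
  assumes "((x, v, y), (x, v', y)) \<in> path_equiv G" "is_walk G x v y" "is_walk G z u x"
  shows "((z, u @ v, y), (z, u @ v', y)) \<in> path_equiv G"
  using assms(1,2)
proof (induction rule: path_equiv_induct)
  case (cancel v l w)
  then have "is_walk G z ((u @ v) @ l # flip l # w) y"
    using assms(3) is_walk_append[of G z u "v @ l # flip l # w" y] by auto
  from path_equiv_cancel[OF this] show ?case by simp
qed (rule path_equiv_refl | erule path_equiv_sym | erule (1) path_equiv_trans)+

lemma path_equiv_reverse:
  assumes "((x, v, y), (x, v', y)) \<in> path_equiv G" "is_walk G x v y"
  shows "((y, rev (map flip v), x), (y, rev (map flip v'), x)) \<in> path_equiv G"
  using assms
proof (induction rule: path_equiv_induct)
  case (cancel v l w)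
  from is_walk_reverse[OF this]
  show ?case
    using path_equiv_cancel[of G y "rev (map flip w)" l "rev (map flip v)" x] by simp
qed (rule path_equiv_refl | erule path_equiv_sym | erule (1) path_equiv_trans)+

text \<open>Peeling letters off the end of \<open>v\<close>: the last letter of \<open>v\<close> and the first of its formal
  inverse are adjacent and cancel.\<close>

lemma path_equiv_reverse_right:
  "is_walk G x v y \<Longrightarrow> ((x, v @ rev (map flip v), x), (x, [], x)) \<in> path_equiv G"
proof (induction v arbitrary: y rule: rev_induct)
  case (snoc l v)
  then obtain z where z: "is_walk G x v z" and l: "is_walk G z [l] y"
    by (auto simp: is_walk_append)
  have "is_walk G x ((v @ [l]) @ rev (map flip (v @ [l]))) x"
    unfolding is_walk_append[of _ _ "v @ [l]"]
    using is_walk_reverse[OF snoc(2)] snoc(2) by (intro exI[of _ y]) simp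
  then have "is_walk G x (v @ l # flip l # rev (map flip v)) x" by simp
  from path_equiv_trans[OF path_equiv_cancel[OF this] snoc(1)[OF z]] show ?case by simp
qed simp


section \<open>The free groupoid\<close>

context
  fixes G :: "('x, 'e, 'm) quiver_scheme"
begin

lemma path_class_walk:
  assumes "is_walk G x v y" "q \<in> path_class G (x, v, y)"
  obtains w where "q = (x, w, y)" "is_walk G x w y" "((x, v, y), (x, w, y)) \<in> path_equiv G"
  using assms path_equiv_walk[of x v y q G] by (auto simp: path_class_iff)

text \<open>A quantity that is constant along equivalences has a well-defined value on a path class.
  This computes source and target, and later the value of a class under an extended map.\<close>

lemma image_path_class:
  assumes w: "is_walk G x w y"
    and const: "\<And>w'. ((x, w, y), (x, w', y)) \<in> path_equiv G \<Longrightarrow> g x w' y = g x w y"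
  shows "(\<lambda>(x, w, y). g x w y) ` path_class G (x, w, y) = {g x w y}"
proof -
  let ?f = "\<lambda>(x, w, y). g x w y"
  have "?f q = g x w y" if q: "q \<in> path_class G (x, w, y)" for q
    using w q
  proof (rule path_class_walk)
    fix w' assume "q = (x, w', y)" "((x, w, y), (x, w', y)) \<in> path_equiv G"
    with const[of w'] show "?f q = g x w y" by simp
  qed
  then have "?f ` path_class G (x, w, y) \<subseteq> {g x w y}" by blast
  moreover have "g x w y \<in> ?f ` path_class G (x, w, y)"
    using imageI[OF path_class_self, of ?f "(x, w, y)" G] by (simp only: prod.case)
  ultimately show ?thesis by blast
qed

lemma free_groupoid_Obj [simp]: "Obj (free_groupoid G) = Obj G"
  by (simp add: free_groupoid_def)

lemma free_groupoid_idt: "idt (free_groupoid G) x = path_class G (x, [], x)"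
  by (simp add: free_groupoid_def)

lemma free_groupoid_ArrI:
  "is_walk G x w y \<Longrightarrow> path_class G (x, w, y) \<in> Arr (free_groupoid G)"
  by (auto simp: free_groupoid_def paths_def)

lemma free_groupoid_ArrE:
  assumes "C \<in> Arr (free_groupoid G)"
  obtains x w y where "C = path_class G (x, w, y)" "is_walk G x w y"
  using assms by (auto simp: free_groupoid_def paths_def)

lemma
  assumes "is_walk G x w y"
  shows free_groupoid_src: "src (free_groupoid G) (path_class G (x, w, y)) = x"
    and free_groupoid_tgt: "tgt (free_groupoid G) (path_class G (x, w, y)) = y"
proof -
  have "(\<lambda>(x, w, y). x) ` path_class G (x, w, y) = {x}"
    "(\<lambda>(x, w, y). y) ` path_class G (x, w, y) = {y}"
    by (rule image_path_class[OF assms], rule refl)+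
  then show "src (free_groupoid G) (path_class G (x, w, y)) = x"
    "tgt (free_groupoid G) (path_class G (x, w, y)) = y"
    by (simp_all add: free_groupoid_def)
qed

lemma free_groupoid_cmp:
  assumes v: "is_walk G x v y" and w: "is_walk G y w z"
  shows "path_class G (x, v, y) \<cdot>\<^bsub>free_groupoid G\<^esub> path_class G (y, w, z)
    = path_class G (x, v @ w, z)"
proof -
  have eq: "path_class G (x, v' @ w', z) = path_class G (x, v @ w, z)"
    if "((x, v, y), (x, v', y)) \<in> path_equiv G" "is_walk G x v' y"
      "((y, w, z), (y, w', z)) \<in> path_equiv G" for v' w'
  proof -
    have "((x, v @ w, z), (x, v' @ w, z)) \<in> path_equiv G"
      using path_equiv_append_right[OF that(1) v w] .
    moreover have "((x, v' @ w, z), (x, v' @ w', z)) \<in> path_equiv G"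
      using path_equiv_append_left[OF that(3) w that(2)] .
    ultimately show ?thesis
      by (metis path_class_eq_iff)
  qed
  have "(\<Union>(x, v, _)\<in>path_class G (x, v, y). \<Union>(_, w, z)\<in>path_class G (y, w, z).
      path_class G (x, v @ w, z)) = path_class G (x, v @ w, z)" (is "?L = ?R")
  proof
    show "?L \<subseteq> ?R"
      by (force elim!: path_class_walk[OF v] path_class_walk[OF w] dest: eq)
    show "?R \<subseteq> ?L"
      using path_class_self[of "(x, v, y)" G] path_class_self[of "(y, w, z)" G] by blast
  qed
  then show ?thesis by (simp add: free_groupoid_def)
qed

lemma free_groupoid_ginv:
  assumes w: "is_walk G x w y"
  shows "ginv (free_groupoid G) (path_class G (x, w, y)) = path_class G (y, rev (map flip w), x)"
proof -
  have "(\<Union>(x, w, y)\<in>path_class G (x, w, y). path_class G (y, rev (map flip w), x))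
     = path_class G (y, rev (map flip w), x)" (is "?L = ?R")
  proof
    show "?L \<subseteq> ?R"
      by (force elim!: path_class_walk[OF w] dest: path_equiv_reverse[OF _ w]
          simp: path_class_eq_iff[symmetric])
    show "?R \<subseteq> ?L"
      using path_class_self[of "(x, w, y)" G] by blast
  qed
  then show ?thesis by (simp add: free_groupoid_def)
qed

text \<open>On representatives the operations are concatenation and formal inversion of words, so
  associativity and the unit laws are those of lists; only the inverse laws need cancellation.\<close>

lemma groupoid_free_groupoid: "groupoid (free_groupoid G)"
proof
  \<comment> \<open>The left inverse law is the right inverse law for the reversed word.\<close>
  have left: "path_class G (x, rev (map flip v) @ v, x) = path_class G (x, [], x)"
    if "is_walk G y v x" for x y v
  proof -
    have "map (flip \<circ> flip) v = v"
      by (simp add: comp_def)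
    then show ?thesis
      using path_equiv_reverse_right[OF is_walk_reverse[OF that]]
      by (simp add: path_class_eq_iff rev_map)
  qed
  note [simp] = free_groupoid_src free_groupoid_tgt free_groupoid_cmp free_groupoid_ginv
    free_groupoid_idt is_walk_reverse is_walk_append left
  have [simp]: "path_class G (x, v @ rev (map flip v), x) = path_class G (x, [], x)"
    if "is_walk G x v y" for x y v
    using path_equiv_reverse_right[OF that] by (simp add: path_class_eq_iff)
  have [simp]: "\<exists>z. is_walk G x v z \<and> is_walk G z w y" if "is_walk G x v z" "is_walk G z w y"
    for x v z w y using that by blast
  let ?F = "free_groupoid G"
  fix a b c x
  {
    assume a: "a \<in> Arr ?F"
    from a show "src ?F a \<in> Obj ?F"
      by (auto elim!: free_groupoid_ArrE dest: is_walk_start)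
    from a show "tgt ?F a \<in> Obj ?F"
      by (auto elim!: free_groupoid_ArrE dest: is_walk_end)
    from a show "idt ?F (src ?F a) \<cdot>\<^bsub>?F\<^esub> a = a"
      by (auto elim!: free_groupoid_ArrE simp: is_walk_start)
    from a show "a \<cdot>\<^bsub>?F\<^esub> idt ?F (tgt ?F a) = a"
      by (auto elim!: free_groupoid_ArrE simp: is_walk_end)
    from a show "ginv ?F a \<in> Arr ?F"
      by (auto elim!: free_groupoid_ArrE intro!: free_groupoid_ArrI)
    from a show "src ?F (ginv ?F a) = tgt ?F a" "tgt ?F (ginv ?F a) = src ?F a"
      by (auto elim!: free_groupoid_ArrE)
    from a show "a \<cdot>\<^bsub>?F\<^esub> ginv ?F a = idt ?F (src ?F a)"
      by (auto elim!: free_groupoid_ArrE)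
    from a show "ginv ?F a \<cdot>\<^bsub>?F\<^esub> a = idt ?F (tgt ?F a)"
      by (auto elim!: free_groupoid_ArrE)
    assume b: "b \<in> Arr ?F" and ab: "tgt ?F a = src ?F b"
    from a b ab show "a \<cdot>\<^bsub>?F\<^esub> b \<in> Arr ?F"
      by (auto elim!: free_groupoid_ArrE intro!: free_groupoid_ArrI)
    from a b ab show "src ?F (a \<cdot>\<^bsub>?F\<^esub> b) = src ?F a" "tgt ?F (a \<cdot>\<^bsub>?F\<^esub> b) = tgt ?F b"
      by (auto elim!: free_groupoid_ArrE intro!: free_groupoid_src free_groupoid_tgt)
    assume c: "c \<in> Arr ?F" and bc: "tgt ?F b = src ?F c"
    obtain x u y where u: "a = path_class G (x, u, y)" "is_walk G x u y"
      using a by (rule free_groupoid_ArrE)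
    obtain y' v z where v: "b = path_class G (y', v, z)" "is_walk G y' v z"
      using b by (rule free_groupoid_ArrE)
    obtain z' w t where w: "c = path_class G (z', w, t)" "is_walk G z' w t"
      using c by (rule free_groupoid_ArrE)
    have eq: "y' = y" "z' = z" using ab bc u v w by simp_all
    have "is_walk G x (u @ v) z" "is_walk G y (v @ w) t"
      using u(2) v(2) w(2) unfolding eq is_walk_append by blast+
    then show "(a \<cdot>\<^bsub>?F\<^esub> b) \<cdot>\<^bsub>?F\<^esub> c = a \<cdot>\<^bsub>?F\<^esub> (b \<cdot>\<^bsub>?F\<^esub> c)"
      using u v w unfolding eq by (simp del: is_walk_append)
  }
  assume "x \<in> Obj ?F"
  then have x: "is_walk G x [] x" by simp
  show "idt ?F x \<in> Arr ?F" "src ?F (idt ?F x) = x" "tgt ?F (idt ?F x) = x"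
    using free_groupoid_ArrI[OF x] free_groupoid_src[OF x] free_groupoid_tgt[OF x] by simp_all
qed

end

text \<open>Without this condition an edge need not be a walk of length one, as walks visit objects
  only.\<close>

locale wf_quiver =
  fixes G :: "('x, 'e, 'm) quiver_scheme"
  assumes src_in_Obj: "e \<in> Arr G \<Longrightarrow> src G e \<in> Obj G"
    and tgt_in_Obj: "e \<in> Arr G \<Longrightarrow> tgt G e \<in> Obj G"
begin

sublocale free: groupoid "free_groupoid G"
  by (rule groupoid_free_groupoid)

lemma is_walk_edge: "e \<in> Arr G \<Longrightarrow> is_walk G (src G e) [(e, True)] (tgt G e)"
  by (simp add: lsrc_def ltgt_def src_in_Obj tgt_in_Obj)

lemma free_gen_closed [simp]: "e \<in> Arr G \<Longrightarrow> free_gen G e \<in> Arr (free_groupoid G)"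
  and src_free_gen [simp]: "e \<in> Arr G \<Longrightarrow> src (free_groupoid G) (free_gen G e) = src G e"
  and tgt_free_gen [simp]: "e \<in> Arr G \<Longrightarrow> tgt (free_groupoid G) (free_gen G e) = tgt G e"
  unfolding free_gen_def
  using free_groupoid_ArrI[OF is_walk_edge[of e]] free_groupoid_src[OF is_walk_edge[of e]]
    free_groupoid_tgt[OF is_walk_edge[of e]] by simp_all

lemma path_class_letter:
  assumes "fst l \<in> Arr G"
  shows "path_class G (lsrc G l, [l], ltgt G l) =
    (if snd l then free_gen G (fst l) else ginv (free_groupoid G) (free_gen G (fst l)))"
proof (cases l)
  case (Pair e b)
  then show ?thesis
    using assms free_groupoid_ginv[OF is_walk_edge[of e]]
    by (cases b) (simp_all add: free_gen_def lsrc_def ltgt_def flip_def)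
qed

text \<open>Every word is a composite of generators and their inverses, so a morphism on the free
  groupoid is determined by its values on the generators.\<close>

lemma free_groupoid_hom_ext:
  assumes "groupoid K" and f: "groupoid_hom (free_groupoid G) K f"
    and g: "groupoid_hom (free_groupoid G) K g"
    and eq: "\<And>e. e \<in> Arr G \<Longrightarrow> f (free_gen G e) = g (free_gen G e)"
    and C: "C \<in> Arr (free_groupoid G)"
  shows "f C = g C"
proof -
  have "f (path_class G (x, w, y)) = g (path_class G (x, w, y))" if "is_walk G x w y" for x w y
    using that
  proof (induction w arbitrary: x)
    case Nil
    then have "x \<in> Obj G" "y = x" by auto
    then show ?case
      using groupoid_homD(5)[OF f, of x] groupoid_homD(5)[OF g, of x] by (simp add: free_groupoid_idt)
  next
    case (Cons l w)
    then have l: "fst l \<in> Arr G" "x = lsrc G l" and w: "is_walk G (ltgt G l) w y" by auto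
    have wl: "is_walk G x [l] (ltgt G l)" using Cons.prems is_walk_start[OF w] by simp
    note h = free_groupoid_ArrI[OF wl] free_groupoid_ArrI[OF w]
    have "f (path_class G (x, [l], ltgt G l)) = g (path_class G (x, [l], ltgt G l))"
      using path_class_letter[OF l(1)] l eq[OF l(1)]
        groupoid_hom_ginv[OF free.groupoid_axioms assms(1) f free_gen_closed[OF l(1)]]
        groupoid_hom_ginv[OF free.groupoid_axioms assms(1) g free_gen_closed[OF l(1)]] by simp
    then show ?case
      using groupoid_homD(6)[OF f h] groupoid_homD(6)[OF g h] Cons.IH[OF w]
        free_groupoid_src[OF w] free_groupoid_tgt[OF wl] free_groupoid_cmp[OF wl w] by simp
  qed
  with C show ?thesis by (auto elim: free_groupoid_ArrE)
qed

end

definition letter_value :: "('x, 'k) groupoid \<Rightarrow> ('e \<Rightarrow> 'k) \<Rightarrow> 'e \<times> bool \<Rightarrow> 'k" where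
  "letter_value K \<phi> l = (if snd l then \<phi> (fst l) else ginv K (\<phi> (fst l)))"

text \<open>The product of the letters of a word in \<open>K\<close>, closed off by the identity at its end point
  so that an empty word still has a value.\<close>

definition walk_value :: "('x, 'k) groupoid \<Rightarrow> ('e \<Rightarrow> 'k) \<Rightarrow> ('e \<times> bool) list \<Rightarrow> 'x \<Rightarrow> 'k" where
  "walk_value K \<phi> w y = foldr (\<lambda>l k. letter_value K \<phi> l \<cdot>\<^bsub>K\<^esub> k) w (idt K y)"

lemma walk_value_simps [simp]:
  "walk_value K \<phi> [] y = idt K y"
  "walk_value K \<phi> (l # w) y = letter_value K \<phi> l \<cdot>\<^bsub>K\<^esub> walk_value K \<phi> w y"
  by (simp_all add: walk_value_def)

locale quiver_map = wf_quiver G + K: groupoid K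
  for G :: "('x, 'e, 'm) quiver_scheme" and K :: "('x, 'k) groupoid" +
  fixes \<phi> :: "'e \<Rightarrow> 'k"
  assumes Obj_subset: "Obj G \<subseteq> Obj K"
    and map_closed: "e \<in> Arr G \<Longrightarrow> \<phi> e \<in> Arr K"
    and src_map: "e \<in> Arr G \<Longrightarrow> src K (\<phi> e) = src G e"
    and tgt_map: "e \<in> Arr G \<Longrightarrow> tgt K (\<phi> e) = tgt G e"
begin

lemma letter_value [simp]:
  assumes "fst l \<in> Arr G"
  shows "letter_value K \<phi> l \<in> Arr K"
    and "src K (letter_value K \<phi> l) = lsrc G l"
    and "tgt K (letter_value K \<phi> l) = ltgt G l"
    and "letter_value K \<phi> (flip l) = ginv K (letter_value K \<phi> l)"
  using assms map_closed[of "fst l"] src_map[of "fst l"] tgt_map[of "fst l"]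
  by (auto simp: letter_value_def lsrc_def ltgt_def flip_def)

lemma walk_value:
  assumes "is_walk G x w y"
  shows "walk_value K \<phi> w y \<in> Arr K \<and> src K (walk_value K \<phi> w y) = x
    \<and> tgt K (walk_value K \<phi> w y) = y"
  using assms
proof (induction w arbitrary: x)
  case Nil
  then show ?case using Obj_subset by auto
next
  case (Cons l w)
  then show ?case by auto
qed

lemma walk_value_append:
  assumes "is_walk G x v y" "is_walk G y w z"
  shows "walk_value K \<phi> (v @ w) z = walk_value K \<phi> v y \<cdot>\<^bsub>K\<^esub> walk_value K \<phi> w z"
  using assms
proof (induction v arbitrary: x)
  case Nil
  then show ?case using walk_value[of y w z] by auto
next
  case (Cons l v)
  then show ?case using walk_value[of y w z] walk_value[of "ltgt G l" v y] by auto
qed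

text \<open>A letter and its formal inverse have mutually inverse values, so a cancelled pair drops out
  of the product.\<close>

lemma walk_value_equiv:
  assumes "((x, v, y), (x, w, y)) \<in> path_equiv G" "is_walk G x v y"
  shows "walk_value K \<phi> v y = walk_value K \<phi> w y"
  using assms
proof (induction rule: path_equiv_induct)
  case (cancel v l w)
  then obtain z where v: "is_walk G x v z" and lw: "is_walk G z (l # flip l # w) y"
    by (auto simp: is_walk_append)
  then have l: "fst l \<in> Arr G" "z = lsrc G l" and w: "is_walk G z w y" by auto
  show ?case
    using walk_value_append[OF v lw] walk_value_append[OF v w] walk_value[OF w] l by simp
qed auto

text \<open>Existence half of the universal property of the free groupoid: the product of a word depends
  only on its path class, and concatenation becomes composition.\<close>

lemma free_groupoid_ext:
  "\<exists>h. groupoid_hom (free_groupoid G) K h \<and> (\<forall>e\<in>Arr G. h (free_gen G e) = \<phi> e)"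
proof -
  define h where "h = (\<lambda>C. the_elem ((\<lambda>(x :: 'x, w, y). walk_value K \<phi> w y) ` C))"
  have h: "h (path_class G (x, w, y)) = walk_value K \<phi> w y" if w: "is_walk G x w y" for x w y
  proof -
    have "(\<lambda>(x, w, y). walk_value K \<phi> w y) ` path_class G (x, w, y) = {walk_value K \<phi> w y}"
      by (rule image_path_class[OF w]) (rule walk_value_equiv[OF _ w, symmetric])
    then show ?thesis by (simp add: h_def)
  qed
  have "groupoid_hom (free_groupoid G) K h"
    unfolding groupoid_hom_def
  proof (intro conjI ballI impI)
    fix a b assume a: "a \<in> Arr (free_groupoid G)"
    then obtain x v y where v: "a = path_class G (x, v, y)" "is_walk G x v y"
      by (rule free_groupoid_ArrE)
    then show "h a \<in> Arr K" "src K (h a) = src (free_groupoid G) a"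
      "tgt K (h a) = tgt (free_groupoid G) a"
      using walk_value[OF v(2)] unfolding v(1) h[OF v(2)] free_groupoid_src[OF v(2)]
        free_groupoid_tgt[OF v(2)] by simp_all
    assume b: "b \<in> Arr (free_groupoid G)" and ab: "tgt (free_groupoid G) a = src (free_groupoid G) b"
    from b obtain y' w z where w: "b = path_class G (y', w, z)" "is_walk G y' w z"
      by (rule free_groupoid_ArrE)
    with v ab have y': "y' = y" by (simp add: free_groupoid_src free_groupoid_tgt)
    have "is_walk G x (v @ w) z" using v(2) w(2) unfolding y' is_walk_append by blast
    with y' show "h (a \<cdot>\<^bsub>free_groupoid G\<^esub> b) = h a \<cdot>\<^bsub>K\<^esub> h b"
      using v w by (simp add: free_groupoid_cmp h walk_value_append)
  next
    fix x assume "x \<in> Obj (free_groupoid G)"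
    then show "h (idt (free_groupoid G) x) = idt K x" by (simp add: free_groupoid_idt h)
  qed (use Obj_subset in auto)
  moreover have "h (free_gen G e) = \<phi> e" if "e \<in> Arr G" for e
    using h[OF is_walk_edge[OF that]] that map_closed tgt_map
    by (simp add: free_gen_def letter_value_def)
  ultimately show ?thesis by blast
qed

end


section \<open>Quotient groupoids\<close>

locale normal_quotient = groupoid G
  for G :: "('x, 'e) groupoid" (structure) +
  fixes N :: "'e set"
  assumes normal: "normal_subgroupoid N G"
begin

lemma idt_in: "x \<in> Obj G \<Longrightarrow> idt G x \<in> N"
  and ginv_in: "a \<in> N \<Longrightarrow> ginv G a \<in> N"
  and cmp_in: "\<lbrakk>a \<in> N; b \<in> N; tgt G a = src G b\<rbrakk> \<Longrightarrow> a \<cdot> b \<in> N"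
  using normal by (auto simp: normal_subgroupoid_def wide_subgroupoid_def subgroupoid_def)

text \<open>Normality is stated with \<open>ginv G a\<close> on the left; applying it to the inverse of \<open>a\<close> gives
  closure under conjugation in the other direction, which suits cosets \<open>b \<cdot> a\<inverse> \<in> N\<close>.\<close>

lemma conj_in:
  assumes "a \<in> Arr G" "n \<in> N" "src G n = tgt G a" "tgt G n = tgt G a"
  shows "(a \<cdot> n) \<cdot> ginv G a \<in> N"
proof -
  have "(ginv G (ginv G a) \<cdot> n) \<cdot> ginv G a \<in> N"
    using normal assms unfolding normal_subgroupoid_def
    by (metis ginv_closed src_ginv)
  then show ?thesis using assms by simp
qed

lemma coset_self [simp]: "a \<in> Arr G \<Longrightarrow> a \<in> coset G N a"
  by (simp add: coset_def idt_in)

lemma coset_sym: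
  assumes "a \<in> Arr G" "b \<in> coset G N a"
  shows "a \<in> coset G N b"
  using assms ginv_in[of "b \<cdot> ginv G a"] by (auto simp: coset_def)

lemma coset_trans:
  assumes "a \<in> Arr G" "b \<in> coset G N a" "c \<in> coset G N b"
  shows "c \<in> coset G N a"
  using assms cmp_in[of "c \<cdot> ginv G b" "b \<cdot> ginv G a"] by (auto simp: coset_def)

lemma coset_eq:
  assumes "a \<in> Arr G" "b \<in> coset G N a"
  shows "coset G N b = coset G N a"
proof -
  have "b \<in> Arr G" using assms(2) by (simp add: coset_def)
  then show ?thesis using assms coset_sym coset_trans by blast
qed

text \<open>With \<open>n = a' \<cdot> a\<inverse>\<close> and \<open>m = b' \<cdot> b\<inverse>\<close> in \<open>N\<close>, the quotient of \<open>a' \<cdot> b'\<close> by \<open>a \<cdot> b\<close> is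
  \<open>n \<cdot> (a \<cdot> m \<cdot> a\<inverse>)\<close>, a product of an element of \<open>N\<close> and a conjugate of one.\<close>

lemma coset_cmp:
  assumes "a \<in> Arr G" "b \<in> Arr G" "tgt G a = src G b" "a' \<in> coset G N a" "b' \<in> coset G N b"
  shows "a' \<cdot> b' \<in> coset G N (a \<cdot> b)"
proof -
  have a': "a' \<in> Arr G" "src G a' = src G a" "tgt G a' = tgt G a" "a' \<cdot> ginv G a \<in> N"
    and b': "b' \<in> Arr G" "src G b' = src G b" "tgt G b' = tgt G b" "b' \<cdot> ginv G b \<in> N"
    using assms by (auto simp: coset_def)
  have "(a \<cdot> (b' \<cdot> ginv G b)) \<cdot> ginv G a \<in> N"
    by (rule conj_in) (use assms a' b' in auto)
  then have "(a' \<cdot> ginv G a) \<cdot> ((a \<cdot> (b' \<cdot> ginv G b)) \<cdot> ginv G a) \<in> N"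
    by (rule cmp_in[OF a'(4)]) (use assms a' b' in auto)
  then show ?thesis using assms a' b' by (simp add: coset_def)
qed

text \<open>With \<open>n = a' \<cdot> a\<inverse>\<close> in \<open>N\<close>, the quotient of \<open>a'\<inverse>\<close> by \<open>a\<inverse>\<close> is the
  conjugate \<open>a\<inverse> \<cdot> n\<inverse> \<cdot> a\<close>.\<close>

lemma coset_ginv:
  assumes "a \<in> Arr G" "a' \<in> coset G N a"
  shows "ginv G a' \<in> coset G N (ginv G a)"
proof -
  have a': "a' \<in> Arr G" "src G a' = src G a" "tgt G a' = tgt G a" "a' \<cdot> ginv G a \<in> N"
    using assms by (auto simp: coset_def)
  have "(ginv G a \<cdot> ginv G (a' \<cdot> ginv G a)) \<cdot> ginv G (ginv G a) \<in> N"
    by (rule conj_in) (use assms a' ginv_in[OF a'(4)] in auto)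
  then show ?thesis using assms a' by (simp add: coset_def)
qed

abbreviation "G_mod_N \<equiv> quotient_groupoid G N"

lemma quotient_Obj [simp]: "Obj G_mod_N = Obj G"
  and quotient_Arr: "Arr G_mod_N = coset G N ` Arr G"
  and quotient_idt [simp]: "idt G_mod_N x = coset G N (idt G x)"
  by (simp_all add: quotient_groupoid_def)

lemma
  assumes "a \<in> Arr G"
  shows quotient_src [simp]: "src G_mod_N (coset G N a) = src G a"
    and quotient_tgt [simp]: "tgt G_mod_N (coset G N a) = tgt G a"
proof -
  have "src G ` coset G N a = {src G a}" "tgt G ` coset G N a = {tgt G a}"
    using coset_self[OF assms] by (auto simp: coset_def)
  then show "src G_mod_N (coset G N a) = src G a" "tgt G_mod_N (coset G N a) = tgt G a"
    by (simp_all add: quotient_groupoid_def)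
qed

lemma quotient_cmp [simp]:
  assumes "a \<in> Arr G" "b \<in> Arr G" "tgt G a = src G b"
  shows "coset G N a \<cdot>\<^bsub>G_mod_N\<^esub> coset G N b = coset G N (a \<cdot> b)"
proof -
  have "(\<Union>a'\<in>coset G N a. \<Union>b'\<in>coset G N b. coset G N (a' \<cdot> b')) =
    (\<Union>a'\<in>coset G N a. \<Union>b'\<in>coset G N b. coset G N (a \<cdot> b))"
    by (intro SUP_cong refl coset_eq[OF _ coset_cmp[OF assms]]) (use assms in auto)
  also have "\<dots> = coset G N (a \<cdot> b)"
    using coset_self[OF assms(1)] coset_self[OF assms(2)] by blast
  finally show ?thesis by (simp add: quotient_groupoid_def)
qed

lemma quotient_ginv [simp]:
  assumes "a \<in> Arr G"
  shows "ginv G_mod_N (coset G N a) = coset G N (ginv G a)"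
proof -
  have "(\<Union>a'\<in>coset G N a. coset G N (ginv G a')) = (\<Union>a'\<in>coset G N a. coset G N (ginv G a))"
    by (intro SUP_cong refl coset_eq[OF _ coset_ginv[OF assms]]) (use assms in auto)
  also have "\<dots> = coset G N (ginv G a)"
    using coset_self[OF assms(1)] by blast
  finally show ?thesis by (simp add: quotient_groupoid_def)
qed

text \<open>Each groupoid law in the quotient is the image of the same law in \<open>G\<close>, by the formulas for the
  operations on cosets.\<close>

lemma groupoid_quotient: "groupoid G_mod_N"
  by unfold_locales (auto simp: quotient_Arr)

lemma quotient_map: "groupoid_hom G G_mod_N (coset G N)"
  by (simp add: groupoid_hom_def quotient_Arr)

text \<open>Two elements \<open>a\<close>, \<open>b\<close> of one coset differ by \<open>b \<cdot> a\<inverse> \<in> N\<close>, which \<open>h\<close> sends to an identity;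
  so \<open>h\<close> is constant on cosets.\<close>

lemma quotient_factor:
  assumes "groupoid K" and h: "groupoid_hom G K h"
    and kernel: "\<And>n. n \<in> N \<Longrightarrow> h n = idt K (src G n)"
  shows "\<exists>g. groupoid_hom G_mod_N K g \<and> (\<forall>a\<in>Arr G. g (coset G N a) = h a)"
proof -
  interpret K: groupoid K by fact
  define g where "g = (\<lambda>C. the_elem (h ` C))"
  have const: "h b = h a" if a: "a \<in> Arr G" and "b \<in> coset G N a" for a b
  proof -
    have b: "b \<in> Arr G" "src G b = src G a" "tgt G b = tgt G a" "b \<cdot> ginv G a \<in> N"
      using that by (auto simp: coset_def)
    have "h b = h ((b \<cdot> ginv G a) \<cdot> a)" using a b by simp
    also have "\<dots> = h (b \<cdot> ginv G a) \<cdot>\<^bsub>K\<^esub> h a"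
      using a b by (intro groupoid_homD(6)[OF h]) auto
    also have "\<dots> = h a"
      using kernel[OF b(4)] a b groupoid_homD[OF h] by simp
    finally show ?thesis .
  qed
  have g: "g (coset G N a) = h a" if "a \<in> Arr G" for a
  proof -
    have "h ` coset G N a = {h a}" using const[OF that] coset_self[OF that] by blast
    then show ?thesis by (simp add: g_def)
  qed
  have "groupoid_hom G_mod_N K g"
    using h g unfolding groupoid_hom_def by (auto simp: quotient_Arr)
  with g show ?thesis by blast
qed

end

text \<open>The family being intersected contains the set of all arrows, so the intersection consists of
  arrows.\<close>

lemma (in groupoid) normal_closure_normal:
  assumes "R \<subseteq> Arr G"
  shows "normal_subgroupoid (normal_closure G R) G"
proof -
  let ?F = "{N. normal_subgroupoid N G \<and> R \<subseteq> N}"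
  have "\<Inter>?F \<subseteq> Arr G" using normal_subgroupoid_Arr assms by blast
  then show ?thesis
    unfolding normal_closure_def normal_subgroupoid_def wide_subgroupoid_def subgroupoid_def
    by auto
qed

lemma (in groupoid) kernel_normal:
  assumes "groupoid K" and h: "groupoid_hom G K h"
  shows "normal_subgroupoid {a \<in> Arr G. h a = idt K (src G a)} G"
proof -
  interpret K: groupoid K by fact
  have inv: "h (ginv G a) = ginv K (h a)" if "a \<in> Arr G" for a
    using groupoid_hom_ginv[OF groupoid_axioms assms that] .
  \<comment> \<open>An arrow sent to an identity is a loop, since \<open>h\<close> preserves end points.\<close>
  have loop: "tgt G a = src G a" if "a \<in> Arr G" "h a = idt K (src G a)" for a
    using groupoid_homD(4)[OF h that(1)] groupoid_homD(1)[OF h, of "src G a"] that by simp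
  show ?thesis
    unfolding normal_subgroupoid_def wide_subgroupoid_def subgroupoid_def
    using groupoid_homD[OF h] inv loop by auto
qed

text \<open>By minimality, the normal closure of a set killed by \<open>h\<close> lies in the kernel of \<open>h\<close>.\<close>

lemma (in groupoid) normal_closure_kernel:
  assumes "groupoid K" "groupoid_hom G K h" "R \<subseteq> Arr G"
    and "\<And>r. r \<in> R \<Longrightarrow> h r = idt K (src G r)"
    and "n \<in> normal_closure G R"
  shows "h n = idt K (src G n)"
  using assms kernel_normal[OF assms(1,2)] unfolding normal_closure_def by blast


section \<open>The groupoid of a pregroupoid\<close>

text \<open>The two conditions on defined composites say that both sides of a relation \<open>[uv] = [u][v]\<close>
  have the same end points, so that \<open>[u][v][uv]\<inverse>\<close> is composable and is a loop.\<close>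

locale pregroupoid = wf_quiver P
  for P :: "('x, 'e) groupoid" +
  assumes src_comp: "defined_comp P u v \<Longrightarrow> src P (u \<cdot>\<^bsub>P\<^esub> v) = src P u"
    and tgt_comp: "defined_comp P u v \<Longrightarrow> tgt P (u \<cdot>\<^bsub>P\<^esub> v) = tgt P v"
begin

lemma relators_subset: "relators P \<subseteq> Arr (free_groupoid P)"
  using tgt_comp by (auto simp: relators_def defined_comp_def)

sublocale quot: normal_quotient "free_groupoid P"
  "normal_closure (free_groupoid P) (relators P)"
  by unfold_locales (rule free.normal_closure_normal[OF relators_subset])

lemma groupoid_M: "groupoid (M P)"
  unfolding M_def by (rule quot.groupoid_quotient)

text \<open>The quotient map is onto, so morphisms on \<open>M P\<close> can be compared on the free groupoid, where
  the generators decide.\<close>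

lemma M_hom_ext:
  assumes K: "groupoid K" and f: "groupoid_hom (M P) K f" and g: "groupoid_hom (M P) K g"
    and eq: "\<And>u. u \<in> Arr P \<Longrightarrow> f (M_incl P u) = g (M_incl P u)"
    and a: "a \<in> Arr (M P)"
  shows "f a = g a"
proof -
  let ?q = "coset (free_groupoid P) (normal_closure (free_groupoid P) (relators P))"
  have q: "groupoid_hom (free_groupoid P) (M P) ?q"
    unfolding M_def by (rule quot.quotient_map)
  have "(f \<circ> ?q) c = (g \<circ> ?q) c" if "c \<in> Arr (free_groupoid P)" for c
    using free_groupoid_hom_ext[OF K groupoid_hom_compose[OF q f] groupoid_hom_compose[OF q g] _ that]
      eq by (simp add: M_incl_def)
  with a show ?thesis by (auto simp: M_def quot.quotient_Arr)
qed

text \<open>A relator is \<open>[u][v][uv]\<inverse>\<close>, so the extension of \<open>\<phi>\<close> to the free groupoid sends it to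
  \<open>\<phi> u \<cdot> \<phi> v \<cdot> (\<phi> u \<cdot> \<phi> v)\<inverse>\<close>, an identity.\<close>

lemma M_hom_exists:
  assumes "groupoid K" "Obj P \<subseteq> Obj K" and \<phi>: "pregroupoid_hom P K \<phi>"
  shows "\<exists>g. groupoid_hom (M P) K g \<and> (\<forall>u\<in>Arr P. g (M_incl P u) = \<phi> u)"
proof -
  interpret K: groupoid K by fact
  interpret quiver_map P K \<phi>
    by unfold_locales (use assms in \<open>auto simp: pregroupoid_hom_def\<close>)
  obtain h where h: "groupoid_hom (free_groupoid P) K h"
    and gen: "\<And>u. u \<in> Arr P \<Longrightarrow> h (free_gen P u) = \<phi> u"
    using free_groupoid_ext by blast
  have "h r = idt K (src (free_groupoid P) r)" if "r \<in> relators P" for r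
  proof -
    let ?F = "free_groupoid P"
    from that obtain u v where r: "r = (free_gen P u \<cdot>\<^bsub>?F\<^esub> free_gen P v) \<cdot>\<^bsub>?F\<^esub>
        ginv ?F (free_gen P (u \<cdot>\<^bsub>P\<^esub> v))" and uv: "defined_comp P u v"
      by (auto simp: relators_def)
    then have in_P: "u \<in> Arr P" "v \<in> Arr P" "tgt P u = src P v" "u \<cdot>\<^bsub>P\<^esub> v \<in> Arr P"
      by (auto simp: defined_comp_def)
    note ends = src_comp[OF uv] tgt_comp[OF uv]
    have comp: "\<phi> (u \<cdot>\<^bsub>P\<^esub> v) = \<phi> u \<cdot>\<^bsub>K\<^esub> \<phi> v"
      using \<phi> uv by (auto simp: pregroupoid_hom_def)
    have "h r = h (free_gen P u \<cdot>\<^bsub>?F\<^esub> free_gen P v) \<cdot>\<^bsub>K\<^esub> h (ginv ?F (free_gen P (u \<cdot>\<^bsub>P\<^esub> v)))"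
      unfolding r using in_P ends by (intro groupoid_homD(6)[OF h]) auto
    also have "h (free_gen P u \<cdot>\<^bsub>?F\<^esub> free_gen P v) = \<phi> u \<cdot>\<^bsub>K\<^esub> \<phi> v"
      using in_P gen by (simp add: groupoid_homD(6)[OF h])
    also have "h (ginv ?F (free_gen P (u \<cdot>\<^bsub>P\<^esub> v))) = ginv K (\<phi> u \<cdot>\<^bsub>K\<^esub> \<phi> v)"
      using groupoid_hom_ginv[OF free.groupoid_axioms assms(1) h] in_P gen comp by simp
    finally show ?thesis
      using in_P ends map_closed src_map tgt_map by (simp add: r)
  qed
  then have "h n = idt K (src (free_groupoid P) n)"
    if "n \<in> normal_closure (free_groupoid P) (relators P)" for n
    using free.normal_closure_kernel[OF assms(1) h relators_subset _ that] by blast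
  then obtain g where g: "groupoid_hom (M P) K g"
    and "\<forall>a\<in>Arr (free_groupoid P). g (coset (free_groupoid P)
      (normal_closure (free_groupoid P) (relators P)) a) = h a"
    using quot.quotient_factor[OF assms(1) h] unfolding M_def by blast
  then have "\<forall>u\<in>Arr P. g (M_incl P u) = \<phi> u"
    using gen by (simp add: M_incl_def)
  with g show ?thesis by blast
qed

theorem M_universal:
  assumes "groupoid K" "Obj P \<subseteq> Obj K" "pregroupoid_hom P K \<phi>"
  shows "\<exists>!g. g \<in> extensional (Arr (M P)) \<and> groupoid_hom (M P) K g \<and>
    (\<forall>u\<in>Arr P. g (M_incl P u) = \<phi> u)"
proof (rule ex_ex1I)
  from M_hom_exists[OF assms] obtain g where g: "groupoid_hom (M P) K g"
    and gu: "\<And>u. u \<in> Arr P \<Longrightarrow> g (M_incl P u) = \<phi> u" by blast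
  have "groupoid_hom (M P) K (restrict g (Arr (M P)))"
    by (rule groupoid_hom_cong[OF groupoid_M g]) simp
  moreover have "M_incl P u \<in> Arr (M P)" if "u \<in> Arr P" for u
    using that by (simp add: M_incl_def M_def quot.quotient_Arr)
  ultimately show "\<exists>g. g \<in> extensional (Arr (M P)) \<and> groupoid_hom (M P) K g \<and>
      (\<forall>u\<in>Arr P. g (M_incl P u) = \<phi> u)"
    using gu by (intro exI[of _ "restrict g (Arr (M P))"]) simp
next
  fix f g
  assume "f \<in> extensional (Arr (M P)) \<and> groupoid_hom (M P) K f \<and> (\<forall>u\<in>Arr P. f (M_incl P u) = \<phi> u)"
    and "g \<in> extensional (Arr (M P)) \<and> groupoid_hom (M P) K g \<and> (\<forall>u\<in>Arr P. g (M_incl P u) = \<phi> u)"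
  then show "f = g"
    using M_hom_ext[OF assms(1), of f g] by (intro extensionalityI[of f _ g]) auto
qed

end


section \<open>The monodromy groupoid of an atlas\<close>

locale adapted_atlas = Q: groupoid Q
  for Q :: "('x, 'e) groupoid" +
  fixes X :: "'x topology" and s :: "'x \<Rightarrow> ('x set \<times> 'e set) set"
    and I :: "'i set" and U :: "'i \<Rightarrow> 'x set" and H :: "'i \<Rightarrow> 'e set"
  assumes Obj_Q: "Obj Q = topspace X"
    and adapted: "globally_adapted X Q s I U H"
begin

abbreviation "W \<equiv> (\<Union>i\<in>I. H i)"

lemma glob_eq: "glob X Q s = generated_subgroupoid Q W"
  using adapted by (simp add: globally_adapted_def glob_atlas_def)

lemma H_subset: "i \<in> I \<Longrightarrow> H i \<subseteq> Arr Q"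
  using adapted
  by (force simp: globally_adapted_def atlas_def L_def wide_subgroupoid_def subgroupoid_def
      full_on_def restr_def)

lemma W_subset: "W \<subseteq> Arr Q"
  using H_subset by blast

lemma idt_in_W:
  assumes "x \<in> Obj Q"
  shows "idt Q x \<in> W"
proof -
  have "(\<Union>i\<in>I. U i) = topspace X"
    using adapted by (simp add: globally_adapted_def atlas_def)
  with assms Obj_Q obtain i where "i \<in> I" "x \<in> U i" by blast
  moreover from this(1) have "H i \<in> L Q (U i)"
    using adapted by (simp add: globally_adapted_def atlas_def)
  ultimately show ?thesis
    by (auto simp: L_def wide_subgroupoid_def full_on_def)
qed

lemma W_subset_glob: "W \<subseteq> glob X Q s"
  unfolding glob_eq generated_subgroupoid_def by blast

text \<open>Because the atlas is globally adapted, \<open>glob X Q s\<close> is a generated subgroupoid and so an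
  intersection over a nonempty family.  It contains all identities because the \<open>U i\<close> cover the
  space and each \<open>H i\<close> is wide on \<open>U i\<close>.\<close>

lemma glob_wide: "wide_subgroupoid (glob X Q s) Q"
proof -
  have "subgroupoid (Arr Q) Q"
    using Q.normal_subgroupoid_Arr by (simp add: normal_subgroupoid_def wide_subgroupoid_def)
  then have sub: "glob X Q s \<subseteq> Arr Q"
    unfolding glob_eq generated_subgroupoid_def using W_subset by blast
  have "subgroupoid (glob X Q s) Q"
    unfolding subgroupoid_def using sub
    by (auto simp: glob_eq generated_subgroupoid_def subgroupoid_def)
  then show ?thesis
    using idt_in_W W_subset_glob by (auto simp: wide_subgroupoid_def)
qed

lemma groupoid_glob: "groupoid (glob_groupoid X Q s)"
  unfolding glob_groupoid_def by (rule Q.wide_subgroupoid_groupoid[OF glob_wide])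

lemma atlas_pregroupoid_simps [simp]:
  "Obj (atlas_pregroupoid Q I H) = Obj Q"
  "Arr (atlas_pregroupoid Q I H) = W"
  "src (atlas_pregroupoid Q I H) = src Q"
  "tgt (atlas_pregroupoid Q I H) = tgt Q"
  "cmp (atlas_pregroupoid Q I H) = cmp Q"
  by (simp_all add: atlas_pregroupoid_def)

lemma glob_groupoid_simps [simp]:
  "Obj (glob_groupoid X Q s) = Obj Q"
  "Arr (glob_groupoid X Q s) = glob X Q s"
  "src (glob_groupoid X Q s) = src Q"
  "tgt (glob_groupoid X Q s) = tgt Q"
  "cmp (glob_groupoid X Q s) = cmp Q"
  by (simp_all add: glob_groupoid_def)

sublocale pre: pregroupoid "atlas_pregroupoid Q I H"
proof
  fix e assume "e \<in> Arr (atlas_pregroupoid Q I H)"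
  then show "src (atlas_pregroupoid Q I H) e \<in> Obj (atlas_pregroupoid Q I H)"
    "tgt (atlas_pregroupoid Q I H) e \<in> Obj (atlas_pregroupoid Q I H)"
    using W_subset by auto
next
  fix u v assume "defined_comp (atlas_pregroupoid Q I H) u v"
  then have "u \<in> Arr Q" "v \<in> Arr Q" "tgt Q u = src Q v"
    using W_subset by (auto simp: defined_comp_def)
  then show "src (atlas_pregroupoid Q I H) (cmp (atlas_pregroupoid Q I H) u v)
      = src (atlas_pregroupoid Q I H) u"
    "tgt (atlas_pregroupoid Q I H) (cmp (atlas_pregroupoid Q I H) u v)
      = tgt (atlas_pregroupoid Q I H) v"
    by simp_all
qed

lemma groupoid_Mon: "groupoid (Mon Q I H)"
  unfolding Mon_def by (rule pre.groupoid_M)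

text \<open>The projection is a definite description; the universal property for the inclusion of \<open>W\<close> in
  \<open>glob X Q s\<close> provides the unique existence that makes the description denote.\<close>

lemma Mon_proj:
  shows "groupoid_hom (Mon Q I H) (glob_groupoid X Q s) (Mon_proj X Q s I H)"
    and "u \<in> W \<Longrightarrow> Mon_proj X Q s I H (Mon_incl Q I H u) = u"
proof -
  have "pregroupoid_hom (atlas_pregroupoid Q I H) (glob_groupoid X Q s) (\<lambda>u. u)"
    using W_subset_glob by (auto simp: pregroupoid_hom_def)
  then have "\<exists>!p. p \<in> extensional (Arr (Mon Q I H)) \<and>
      groupoid_hom (Mon Q I H) (glob_groupoid X Q s) p \<and>
      (\<forall>u\<in>W. p (Mon_incl Q I H u) = u)"
    using pre.M_universal[OF groupoid_glob] by (simp add: Mon_def Mon_incl_def)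
  from theI'[OF this]
  show "groupoid_hom (Mon Q I H) (glob_groupoid X Q s) (Mon_proj X Q s I H)"
    "u \<in> W \<Longrightarrow> Mon_proj X Q s I H (Mon_incl Q I H u) = u"
    unfolding Mon_proj_def by auto
qed

lemma glue_eq:
  assumes "local_morphism Q I U H K f" "i \<in> I" "u \<in> H i"
  shows "glue I H f u = f i u"
proof -
  define j where "j = (SOME j. j \<in> I \<and> u \<in> H j)"
  have "j \<in> I \<and> u \<in> H j" unfolding j_def 
    by (rule someI[of "\<lambda>j. j \<in> I \<and> u \<in> H j" i]) (use assms(2,3) in simp)
  then have "f j u = f i u" using assms unfolding local_morphism_def by blast
  then show ?thesis by (simp add: glue_def j_def)
qed

theorem weak_monodromy:
  assumes "groupoid K" "Obj K = topspace X" and f: "local_morphism Q I U H K f"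
  shows "\<exists>!Mf. Mf \<in> extensional (Arr (Mon Q I H)) \<and> groupoid_hom (Mon Q I H) K Mf \<and>
    (\<forall>i\<in>I. \<forall>h\<in>H i. Mf (Mon_incl Q I H h) = f i h)"
proof -
  have "pregroupoid_hom (atlas_pregroupoid Q I H) K (glue I H f)"
    using f by (simp add: local_morphism_def)
  from pre.M_universal[OF assms(1) _ this]
  have "\<exists>!g. g \<in> extensional (Arr (Mon Q I H)) \<and> groupoid_hom (Mon Q I H) K g \<and>
      (\<forall>u\<in>W. g (Mon_incl Q I H u) = glue I H f u)"
    using assms(2) Obj_Q by (simp add: Mon_def Mon_incl_def)
  then show ?thesis using glue_eq[OF f] by simp
qed

text \<open>Existence transports the morphism on the monodromy groupoid along the inverse of the
  projection.  For uniqueness, two extensions become morphisms on the monodromy groupoid after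
  composition with the projection; these agree on generators, and the projection is onto.\<close>

theorem glob_extension:
  assumes K: "groupoid K" "Obj K = topspace X" and f: "local_morphism Q I U H K f"
    and iso: "groupoid_iso (Mon Q I H) (glob_groupoid X Q s) (Mon_proj X Q s I H)"
  shows "\<exists>!F. F \<in> extensional (glob X Q s) \<and> groupoid_hom (glob_groupoid X Q s) K F \<and>
    (\<forall>i\<in>I. \<forall>h\<in>H i. F h = f i h)"
proof (rule ex_ex1I)
  let ?p = "Mon_proj X Q s I H" and ?q = "inv_into (Arr (Mon Q I H)) (Mon_proj X Q s I H)"
  obtain g where g: "groupoid_hom (Mon Q I H) K g"
    and gf: "\<And>i h. i \<in> I \<Longrightarrow> h \<in> H i \<Longrightarrow> g (Mon_incl Q I H h) = f i h"
    using weak_monodromy[OF K f] by blast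
  have incl: "Mon_incl Q I H u \<in> Arr (Mon Q I H)" if "u \<in> W" for u
    using that unfolding Mon_def Mon_incl_def M_def M_incl_def
    by (simp add: pre.quot.quotient_Arr)
  have qi: "?q u = Mon_incl Q I H u" if "u \<in> W" for u
    using inv_into_f_f[of ?p, OF _ incl[OF that]] Mon_proj(2)[OF that] iso
    by (simp add: groupoid_iso_def bij_betw_def)
  have "groupoid_hom (glob_groupoid X Q s) K (g \<circ> ?q)"
    using groupoid_hom_compose[OF groupoid_hom_inv_into[OF groupoid_Mon iso] g] .
  then have "groupoid_hom (glob_groupoid X Q s) K (restrict (g \<circ> ?q) (glob X Q s))"
    by (rule groupoid_hom_cong[OF groupoid_glob]) simp
  moreover have "restrict (g \<circ> ?q) (glob X Q s) h = f i h" if "i \<in> I" "h \<in> H i" for i h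
  proof -
    have "h \<in> W" using that by blast
    then show ?thesis using W_subset_glob qi gf[OF that] by auto
  qed
  ultimately show "\<exists>F. F \<in> extensional (glob X Q s) \<and> groupoid_hom (glob_groupoid X Q s) K F \<and>
      (\<forall>i\<in>I. \<forall>h\<in>H i. F h = f i h)"
    by (intro exI[of _ "restrict (g \<circ> ?q) (glob X Q s)"]) simp
next
  let ?p = "Mon_proj X Q s I H"
  fix F F'
  assume F: "F \<in> extensional (glob X Q s) \<and> groupoid_hom (glob_groupoid X Q s) K F \<and>
      (\<forall>i\<in>I. \<forall>h\<in>H i. F h = f i h)"
    and F': "F' \<in> extensional (glob X Q s) \<and> groupoid_hom (glob_groupoid X Q s) K F' \<and>
      (\<forall>i\<in>I. \<forall>h\<in>H i. F' h = f i h)"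
  have agree: "(F \<circ> ?p) a = (F' \<circ> ?p) a" if "a \<in> Arr (Mon Q I H)" for a
    using that unfolding Mon_def
  proof (rule pre.M_hom_ext[OF K(1), rotated -1])
    show "groupoid_hom (M (atlas_pregroupoid Q I H)) K (F \<circ> ?p)"
      "groupoid_hom (M (atlas_pregroupoid Q I H)) K (F' \<circ> ?p)"
      using groupoid_hom_compose Mon_proj(1) F F' unfolding Mon_def by blast+
  qed (use Mon_proj(2) F F' in \<open>auto simp: Mon_incl_def\<close>)
  have surj: "?p ` Arr (Mon Q I H) = glob X Q s"
    using iso by (simp add: groupoid_iso_def bij_betw_def)
  have "F b = F' b" if "b \<in> glob X Q s" for b
  proof -
    from that have "b \<in> ?p ` Arr (Mon Q I H)" by (simp only: surj)
    then obtain a where "b = ?p a" "a \<in> Arr (Mon Q I H)" by (rule imageE)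
    with agree[of a] show ?thesis by simp
  qed
  then show "F = F'" using F F' by (intro extensionalityI[of F _ F']) auto
qed

end

theorem theorem2p3:
  fixes X :: "'x topology"
    and Q :: "('x, 'e) groupoid"
    and s :: "'x \<Rightarrow> ('x set \<times> 'e set) set"
    and I :: "'i set"
    and U :: "'i \<Rightarrow> 'x set"
    and H :: "'i \<Rightarrow> 'e set"
    and K :: "('x, 'k) groupoid"
    and f :: "'i \<Rightarrow> 'e \<Rightarrow> 'k"
  assumes "groupoid Q" and "Obj Q = topspace X"
    and "local_subgroupoid X Q s"
    and "globally_adapted X Q s I U H"
    and "groupoid K" and "Obj K = topspace X"
    and "local_morphism Q I U H K f"
  shows "(\<exists>!Mf. Mf \<in> extensional (Arr (Mon Q I H)) \<and>
            groupoid_hom (Mon Q I H) K Mf \<and>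
            (\<forall>i\<in>I. \<forall>h\<in>H i. Mf (Mon_incl Q I H h) = f i h))
       \<and> (simply_connected_via X Q s I U H \<longrightarrow>
           (\<exists>!F. F \<in> extensional (glob X Q s) \<and>
              groupoid_hom (glob_groupoid X Q s) K F \<and>
              (\<forall>i\<in>I. \<forall>h\<in>H i. F h = f i h)))
       \<and> (simply_connected_local X Q s \<longrightarrow>
           (\<exists>(J :: ('x set \<times> 'e set) set) V N. simply_connected_via X Q s J V N \<and>
              (\<forall>(K' :: ('x, 'k) groupoid) g.
                 groupoid K' \<and> Obj K' = topspace X \<and> local_morphism Q J V N K' g \<longrightarrow>
                 (\<exists>!F. F \<in> extensional (glob X Q s) \<and>
                    groupoid_hom (glob_groupoid X Q s) K' F \<and>
                    (\<forall>j\<in>J. \<forall>h\<in>N j. F h = g j h)))))"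
proof (intro conjI impI)
  have atlas: "adapted_atlas Q X s I U H"
    using assms by (intro adapted_atlas.intro adapted_atlas_axioms.intro)
  show "\<exists>!Mf. Mf \<in> extensional (Arr (Mon Q I H)) \<and> groupoid_hom (Mon Q I H) K Mf \<and>
      (\<forall>i\<in>I. \<forall>h\<in>H i. Mf (Mon_incl Q I H h) = f i h)"
    using adapted_atlas.weak_monodromy[OF atlas assms(5-7)] .
  show "\<exists>!F. F \<in> extensional (glob X Q s) \<and> groupoid_hom (glob_groupoid X Q s) K F \<and>
      (\<forall>i\<in>I. \<forall>h\<in>H i. F h = f i h)" if "simply_connected_via X Q s I U H"
    using adapted_atlas.glob_extension[OF atlas assms(5-7)] that
    by (simp add: simply_connected_via_def)
next
  assume "simply_connected_local X Q s"
  then obtain J :: "('x set \<times> 'e set) set" and V N where sc: "simply_connected_via X Q s J V N"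
    by (auto simp: simply_connected_local_def)
  then have atlas: "adapted_atlas Q X s J V N"
    using assms by (intro adapted_atlas.intro adapted_atlas_axioms.intro)
      (auto simp: simply_connected_via_def)
  have "\<exists>!F. F \<in> extensional (glob X Q s) \<and> groupoid_hom (glob_groupoid X Q s) K' F \<and>
      (\<forall>j\<in>J. \<forall>h\<in>N j. F h = g j h)"
    if "groupoid K' \<and> Obj K' = topspace X \<and> local_morphism Q J V N K' g"
    for K' :: "('x, 'k) groupoid" and g
    using that adapted_atlas.glob_extension[OF atlas, of K' g] sc
    by (simp only: simply_connected_via_def)
  with sc show "\<exists>(J :: ('x set \<times> 'e set) set) V N. simply_connected_via X Q s J V N \<and>
      (\<forall>(K' :: ('x, 'k) groupoid) g.
         groupoid K' \<and> Obj K' = topspace X \<and> local_morphism Q J V N K' g \<longrightarrow>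
         (\<exists>!F. F \<in> extensional (glob X Q s) \<and>
            groupoid_hom (glob_groupoid X Q s) K' F \<and>
            (\<forall>j\<in>J. \<forall>h\<in>N j. F h = g j h)))"
    by (intro exI[of _ J] exI[of _ V] exI[of _ N] conjI allI impI)
qed

end
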